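(* Let $\mathbb F\in\{\mathbb R,\mathbb C,\mathbb H\}$ with $d=\dim_{\mathbb R}\mathbb F$, let $p>q\ge 1$ be integers, and let $G/K=\mathcal G_{p,q}(\mathbb F)$. For $\lambda\in\mathbb C^q$ and $t\in\mathbb R^q$, the spherical function $\varphi^p_\lambda(a_t)=\int_K e^{(i\lambda-\rho^{BC})(H(a_tk))}\,dk$ of $G/K$ is given by $$\varphi_\lambda^{p}(a_t)=\int_{K}\Delta_{(i\lambda-\rho^{BC})/2}(x_t(k))\,dk ,$$ where for $k=\begin{pmatrix}u&0\\0&v\end{pmatrix}\in K$ with $u\in U(q,\mathbb F)$, $v\in U(p,\mathbb F)$, $$x_t(k):=(\cosh\underline t\,u+\sinh\underline t\,\sigma_0^*v\sigma_0)^*(\cosh\underline t\,u+\sinh\underline t\,\sigma_0^*v\sigma_0)\in\Omega_q .$$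
   Context: $M_{q,p}(\mathbb F)$ is the set of $q\times p$ matrices over $\mathbb F$, $M_q(\mathbb F)=M_{q,q}(\mathbb F)$, $X^*=\overline X^t$, and $U(q,\mathbb F)=\{X\in M_q(\mathbb F):X^*X=I_q\}$. $G$ is $SO_0(q,p)$, $SU(q,p)$, $Sp(q,p)$ for $\mathbb F=\mathbb R,\mathbb C,\mathbb H$ respectively, realized as the identity component of the group of ($\mathbb F$-linear, determinant-one) isometries of the form $|x_1|^2+\dots+|x_q|^2-|x_{q+1}|^2-\dots-|x_{p+q}|^2$ on $\mathbb F^{p+q}$. $K$ is the maximal compact subgroup of $(q,p)$-block diagonal matrices $SO(q)\times SO(p)$, $S(U(q)\times U(p))$, $Sp(q)\times Sp(p)$ respectively, and $dk$ is its normalized Haar measure. For $t=(t_1,\dots,t_q)\in\mathbb R^q$ let $\underline t=\mathrm{diag}(t_1,\dots,t_q)$, $\cosh\underline t=\mathrm{diag}(\cosh t_i)$, $\sinh\underline t=\mathrm{diag}(\sinh t_i)$, and, in $(q,q,p-q)$-block form, $$H_t=\begin{pmatrix}0&\underline t&0\\ \underline t&0&0\\0&0&0\end{pmatrix},\qquad a_t=\exp(H_t)=\begin{pmatrix}\cosh\underline t&\sinh\underline t&0\\ \sinh\underline t&\cosh\underline t&0\\0&0&I_{p-q}\end{pmatrix}.$$ $\mathfrak a=\{H_t:t\in\mathbb R^q\}$ is a maximal abelian subspace of $\mathfrak p$ in the Cartan decomposition $\mathfrak g=\mathfrak k\oplus\mathfrak p$. $\mathfrak a_{\mathbb C}^*$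 is identified with $\mathbb C^q$ via $\lambda(H_t)=\sum_{r}\lambda_rt_r$. With $f_i(H_t)=t_i$, the positive restricted roots are $f_i$, $2f_i$ ($1\le i\le q$), $f_i\pm f_j$ ($1\le i<j\le q$), with multiplicities $d(p-q)$, $d-1$, $d$ respectively (multiplicity $0$ allowed for $2f_i$ when $d=1$), and the weighted half sum of positive roots is $$\rho^{BC}=\sum_{i=1}^q\Bigl(\tfrac d2(p+q+2-2i)-1\Bigr)f_i .$$ $\mathfrak n$ is the sum of the positive root spaces, $N=\exp\mathfrak n$, $A=\exp\mathfrak a$, $G=KAN$ is the Iwasawa decomposition, and for $g\in G$, $H(g)\in\mathfrak a$ is the unique element with $g\in K\exp(H(g))N$. $\Omega_q$ is the cone of strictly positive definite Hermitian matrices in $M_q(\mathbb F)$. $\Delta_r(x)$ is the $r$-th principal minor (determinant of the upper left $r\times r$ block); for $\mathbb F=\mathbb H$ the determinant is $\det(A)=(\det_{\mathbb C}A)^{1/2}$, where $A\in M_r(\mathbb H)$ is viewed as a complex $2r\times2r$ matrix. For $\lambda\in\mathbb C^q$ and $x\in\Omega_q$ the power function is $$\Delta_\lambda(x)=\Delta_1(x)^{\lambda_1-\lambda_2}\cdots\Delta_{q-1}(x)^{\lambda_{q-1}-\lambda_q}\Delta_q(x)^{\lambda_q}.$$ Finally $\sigma_0=\begin{pmatrix}I_q\\0_{(p-q)\times q}\end{pmatrix}\in M_{p,q}(\mathbb F)$. *)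

theory Defs
  imports "HOL-Analysis.Analysis"
begin

section \<open>Quaternions\<close>

text \<open>\<open>Quat a b c d\<close> is \<open>a + b i + c j + d k\<close>.\<close>

datatype quat = Quat (qRe: real) (qI: real) (qJ: real) (qK: real)

lemma quat_eq_iff:
  "x = y \<longleftrightarrow> qRe x = qRe y \<and> qI x = qI y \<and> qJ x = qJ y \<and> qK x = qK y"
  by (cases x; cases y) auto

instantiation quat :: ring_1
begin

definition "0 = Quat 0 0 0 0"
definition "1 = Quat 1 0 0 0"
definition "x + y = Quat (qRe x + qRe y) (qI x + qI y) (qJ x + qJ y) (qK x + qK y)"
definition "x - y = Quat (qRe x - qRe y) (qI x - qI y) (qJ x - qJ y) (qK x - qK y)"
definition "- x = Quat (- qRe x) (- qI x) (- qJ x) (- qK x)"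
definition "x * y = Quat
  (qRe x * qRe y - qI x * qI y - qJ x * qJ y - qK x * qK y)
  (qRe x * qI y + qI x * qRe y + qJ x * qK y - qK x * qJ y)
  (qRe x * qJ y - qI x * qK y + qJ x * qRe y + qK x * qI y)
  (qRe x * qK y + qI x * qJ y - qJ x * qI y + qK x * qRe y)"

instance
  by standard
    (auto simp: quat_eq_iff zero_quat_def one_quat_def plus_quat_def minus_quat_def
      uminus_quat_def times_quat_def algebra_simps)

end

instantiation quat :: real_vector
begin

definition "r *\<^sub>R x = Quat (r * qRe x) (r * qI x) (r * qJ x) (r * qK x)" for r :: real and x :: quat

instance
  by standard (auto simp: quat_eq_iff plus_quat_def scaleR_quat_def algebra_simps)

end

instantiation quat :: real_inner
begin

definition "inner x y = qRe x * qRe y + qI x * qI y + qJ x * qJ y + qK x * qK y"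
definition "norm x = sqrt (inner x x)" for x :: quat
definition "sgn x = x /\<^sub>R norm x" for x :: quat
definition "dist x y = norm (x - y)" for x y :: quat
definition "(uniformity :: (quat \<times> quat) filter) = (INF e\<in>{0<..}. principal {(x, y). dist x y < e})"
definition "open U \<longleftrightarrow> (\<forall>x\<in>U. eventually (\<lambda>(x', y). x' = x \<longrightarrow> y \<in> U) uniformity)"
  for U :: "quat set"

instance
proof
  fix x :: quat
  show "0 \<le> x \<bullet> x"
    by (simp add: inner_quat_def)
  show "x \<bullet> x = 0 \<longleftrightarrow> x = 0"
    using not_sum_power2_lt_zero[of "qRe x" "qI x"] not_sum_power2_lt_zero[of "qJ x" "qK x"]
    by (auto simp: inner_quat_def quat_eq_iff zero_quat_def add_nonneg_eq_0_iff)
qed (auto simp: quat_eq_iff plus_quat_def minus_quat_def scaleR_quat_def inner_quat_def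
      norm_quat_def sgn_quat_def dist_quat_def uniformity_quat_def open_quat_def algebra_simps)

end

definition qcnj :: "quat \<Rightarrow> quat"
  where "qcnj x = Quat (qRe x) (- qI x) (- qJ x) (- qK x)"

instantiation quat :: real_normed_div_algebra
begin

definition "inverse x = qcnj x /\<^sub>R (norm x)\<^sup>2"
definition "x div y = x * inverse y" for x y :: quat

instance
proof
  fix x y :: quat and r :: real
  show s: "(r *\<^sub>R x) * y = r *\<^sub>R (x * y)" "x * (r *\<^sub>R y) = r *\<^sub>R (x * y)" for r and x y :: quat
    by (simp_all add: quat_eq_iff times_quat_def scaleR_quat_def algebra_simps)
  have "(x * y) \<bullet> (x * y) = (x \<bullet> x) * (y \<bullet> y)"
    unfolding inner_quat_def times_quat_def quat.sel by (simp add: algebra_simps)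
  then show "norm (x * y) = norm x * norm y"
    by (simp add: norm_quat_def real_sqrt_mult)
  have c: "qcnj x * x = (x \<bullet> x) *\<^sub>R 1" "x * qcnj x = (x \<bullet> x) *\<^sub>R 1"
    by (simp_all add: qcnj_def quat_eq_iff times_quat_def one_quat_def scaleR_quat_def
        inner_quat_def)
  show "inverse x * x = 1" "x * inverse x = 1" if "x \<noteq> 0"
    using that by (simp_all add: inverse_quat_def s c power2_norm_eq_inner)
  show "x div y = x * inverse y"
    by (rule divide_quat_def)
  show "inverse (0 :: quat) = 0"
    by (simp add: inverse_quat_def qcnj_def quat_eq_iff zero_quat_def scaleR_quat_def)
qed

end

instantiation quat :: euclidean_space
begin

definition "Basis = {Quat 1 0 0 0, Quat 0 1 0 0, Quat 0 0 1 0, Quat 0 0 0 1}"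

instance
proof
  show "(Basis :: quat set) \<noteq> {}" "finite (Basis :: quat set)"
    by (simp_all add: Basis_quat_def)
  show "u \<bullet> v = (if u = v then 1 else 0)" if "u \<in> Basis" "v \<in> Basis" for u v :: quat
    using that unfolding Basis_quat_def by (elim insertE emptyE) (simp_all add: inner_quat_def)
  show "(\<forall>u\<in>Basis. x \<bullet> u = 0) \<longleftrightarrow> x = 0" for x :: quat
    by (cases x) (simp add: Basis_quat_def inner_quat_def zero_quat_def)
qed

end

lemma DIM_quat [simp]: "DIM(quat) = 4"
  by (simp add: Basis_quat_def)

definition complex_to_quat :: "complex \<Rightarrow> quat"
  where "complex_to_quat z = Quat (Re z) (Im z) 0 0"


section \<open>The scalars: real numbers, complex numbers, quaternions\<close>

text \<open>
  The range condition leaves, up to isomorphism, exactly the three instances below, so that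
  a statement for all \<open>'a :: rch\<close> is a statement for all three algebras. The real dimension
  of \<open>'a\<close> is \<open>DIM('a)\<close>.
\<close>

class rch = real_normed_div_algebra + euclidean_space +
  fixes quat_of :: "'a \<Rightarrow> quat"
    and conj :: "'a \<Rightarrow> 'a"
  assumes quat_of_add: "quat_of (x + y) = quat_of x + quat_of y"
    and quat_of_mult: "quat_of (x * y) = quat_of x * quat_of y"
    and quat_of_scaleR: "quat_of (scaleR r x) = r *\<^sub>R quat_of x"
    and quat_of_1: "quat_of 1 = 1"
    and norm_quat_of: "norm (quat_of x) = norm x"
    and quat_of_conj: "quat_of (conj x) = qcnj (quat_of x)"
    and range_quat_of: "range quat_of \<in> {range of_real, range complex_to_quat, UNIV}"

lemma of_real_quat: "(of_real r :: quat) = Quat r 0 0 0"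
  by (simp add: of_real_def scaleR_quat_def one_quat_def)

instantiation real :: rch
begin
definition "quat_of (x :: real) = of_real x"
definition "conj (x :: real) = x"
instance
  by standard
    (auto simp: quat_of_real_def conj_real_def qcnj_def of_real_quat one_quat_def norm_quat_def
      inner_quat_def quat_eq_iff plus_quat_def times_quat_def scaleR_quat_def)
end

instantiation complex :: rch
begin
definition "quat_of (x :: complex) = complex_to_quat x"
definition "conj (x :: complex) = cnj x"
instance
  by standard
    (auto simp: complex_to_quat_def conj_complex_def qcnj_def one_quat_def norm_quat_def
      inner_quat_def quat_eq_iff plus_quat_def times_quat_def scaleR_quat_def quat_of_complex_def
      cmod_def power2_eq_square)
end

instantiation quat :: rch
begin
definition "quat_of (x :: quat) = x"
definition "conj (x :: quat) = qcnj x"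
instance
  by standard (auto simp: quat_of_quat_def conj_quat_def)
end


section \<open>Matrices and determinants\<close>

definition adj :: "'a::rch^'n^'m \<Rightarrow> 'a^'m^'n"
  where "adj A = (\<chi> i j. conj (A $ j $ i))"

definition diag :: "real^'n \<Rightarrow> 'a::rch^'n^'n"
  where "diag t = (\<chi> i j. if i = j then of_real (t $ i) else 0)"

definition mexp :: "'a::rch^'n^'n \<Rightarrow> 'a^'n^'n"
  where "mexp X = (\<Sum>n. (1 / fact n) *\<^sub>R (((**) X ^^ n) (mat 1)))"

definition unitary :: "('a::rch^'n^'n) set"
  where "unitary = {X. adj X ** X = mat 1}"

text \<open>Determinant of the submatrix with row and column indices in \<open>S\<close>.\<close>

definition det_on :: "'n set \<Rightarrow> 'b::comm_ring_1^'n^'n \<Rightarrow> 'b"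
  where "det_on S A = (\<Sum>\<pi> | \<pi> permutes S. of_int (sign \<pi>) * (\<Prod>i\<in>S. A $ i $ \<pi> i))"

lemma det_on_UNIV: "det_on UNIV A = det A"
  by (simp add: det_on_def det_def)

text \<open>A quaternion is \<open>z + w j\<close> with \<open>z\<close>, \<open>w\<close> complex; a quaternionic matrix \<open>A\<^sub>1 + A\<^sub>2 j\<close> is
  viewed as the complex block matrix with rows \<open>(A\<^sub>1, A\<^sub>2)\<close> and \<open>(- cnj A\<^sub>2, cnj A\<^sub>1)\<close>.\<close>

definition cpart1 :: "'a::rch \<Rightarrow> complex"
  where "cpart1 x = Complex (qRe (quat_of x)) (qI (quat_of x))"

definition cpart2 :: "'a::rch \<Rightarrow> complex"
  where "cpart2 x = Complex (qJ (quat_of x)) (qK (quat_of x))"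

definition complexify :: "'a::rch^'n^'n \<Rightarrow> complex^('n + 'n)^('n + 'n)"
  where "complexify A = (\<chi> i j. case (i, j) of
      (Inl k, Inl l) \<Rightarrow> cpart1 (A $ k $ l)
    | (Inl k, Inr l) \<Rightarrow> cpart2 (A $ k $ l)
    | (Inr k, Inl l) \<Rightarrow> - cnj (cpart2 (A $ k $ l))
    | (Inr k, Inr l) \<Rightarrow> cnj (cpart1 (A $ k $ l)))"

text \<open>The principal minor on \<open>S\<close>, as a complex number: the usual determinant over the real and
  complex numbers, the square root of the complex determinant over the quaternions.\<close>

definition minor :: "'n set \<Rightarrow> 'a::rch^'n^'n \<Rightarrow> complex"
  where "minor S A =
    (if DIM('a) = 4 then csqrt (det_on (S <+> S) (complexify A))
     else det_on S (\<chi> i j. cpart1 (A $ i $ j)))"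

abbreviation Det :: "'a::rch^'n^'n \<Rightarrow> complex"
  where "Det \<equiv> minor UNIV"

lemma minor_real: "minor S (A :: real^'n^'n) = of_real (det_on S A)"
  by (simp add: minor_def det_on_def cpart1_def quat_of_real_def of_real_quat
      flip: complex_of_real_def)

lemma minor_complex: "minor S (A :: complex^'n^'n) = det_on S A"
  by (simp add: minor_def det_on_def cpart1_def quat_of_complex_def complex_to_quat_def)

lemma Det_quat: "Det (A :: quat^'n^'n) = csqrt (det (complexify A))"
  by (simp add: minor_def det_on_UNIV)

definition pos_def :: "('a::rch^'n^'n) set"
  where "pos_def = {x. adj x = x \<and>
    (\<forall>v. v \<noteq> 0 \<longrightarrow> (\<exists>c>0. (\<Sum>i\<in>UNIV. conj (v $ i) * (x *v v) $ i) = of_real c))}"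

text \<open>The ordered index type \<open>'q\<close> plays the role of \<open>1 < \<dots> < q\<close>. The factor at \<open>r\<close> below is
  \<open>\<Delta>\<^sub>r(x)\<close> to the power \<open>\<lambda>\<^sub>r - \<lambda>\<^sub>r\<^sub>+\<^sub>1\<close>, with \<open>\<lambda>\<^sub>q\<^sub>+\<^sub>1\<close> read as \<open>0\<close>.\<close>

definition power_fun :: "complex^('q::{finite,linorder}) \<Rightarrow> 'a::rch^('q::{finite,linorder})^('q::{finite,linorder}) \<Rightarrow> complex"
  where "power_fun lam x = (\<Prod>r\<in>UNIV. minor {..r} x powr
    (lam $ r - (if {r<..} = {} then 0 else lam $ Min {r<..})))"


section \<open>The groups\<close>

text \<open>
  The numbers \<open>q\<close> and \<open>p\<close> are \<open>CARD('q)\<close> and \<open>CARD('q + 'r)\<close>; thus \<open>p - q = CARD('r)\<close>, and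
  \<open>p > q \<ge> 1\<close> because types are nonempty. Matrices of size \<open>p + q\<close> in \<open>(q, q, p - q)\<close>-block form
  are indexed by \<open>'q + ('q + 'r)\<close>.
\<close>

type_synonym ('a, 'q, 'r) gmat = "'a^('q + ('q + 'r))^('q + ('q + 'r))"

definition form :: "'a::rch^('q::finite + 'p::finite) \<Rightarrow> real"
  where "form x = (\<Sum>i\<in>UNIV. (norm (x $ Inl i))\<^sup>2) - (\<Sum>j\<in>UNIV. (norm (x $ Inr j))\<^sup>2)"

definition isometries :: "('a::rch, 'q::finite, 'r::finite) gmat set"
  where "isometries = {g. (\<forall>x. form (g *v x) = form x) \<and> Det g = 1}"

definition grp_G :: "('a::rch, 'q::finite, 'r::finite) gmat set"
  where "grp_G = connected_component_set isometries (mat 1)"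

definition block_diag ::
    "'a::rch^'q^'q \<Rightarrow> 'a^'p^'p \<Rightarrow> 'a^('q::finite + 'p::finite)^('q + 'p)"
  where "block_diag u v = (\<chi> i j. case (i, j) of
      (Inl k, Inl l) \<Rightarrow> u $ k $ l
    | (Inr k, Inr l) \<Rightarrow> v $ k $ l
    | _ \<Rightarrow> 0)"

definition grp_K :: "('a::rch, 'q::finite, 'r::finite) gmat set"
  where "grp_K = {block_diag u v |u v. u \<in> unitary \<and> v \<in> unitary \<and>
    (if DIM('a) = 1 then Det u = 1 \<and> Det v = 1
     else if DIM('a) = 2 then Det u * Det v = 1
     else True)}"

definition normalized_haar :: "('a::rch^'n^'n) set \<Rightarrow> ('a^'n^'n) measure \<Rightarrow> bool"
  where "normalized_haar K \<mu> \<longleftrightarrow>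
    sets \<mu> = sets (restrict_space borel K) \<and> emeasure \<mu> K = 1 \<and>
    (\<forall>k\<in>K. \<forall>S\<in>sets \<mu>. emeasure \<mu> ((**) k ` S) = emeasure \<mu> S)"

definition H_mat :: "real^'q \<Rightarrow> ('a::rch, 'q::finite, 'r::finite) gmat"
  where "H_mat t = (\<chi> i j. case (i, j) of
      (Inl k, Inr (Inl l)) \<Rightarrow> diag t $ k $ l
    | (Inr (Inl k), Inl l) \<Rightarrow> diag t $ k $ l
    | _ \<Rightarrow> 0)"

definition a_mat :: "real^'q \<Rightarrow> ('a::rch, 'q::finite, 'r::finite) gmat"
  where "a_mat t = mexp (H_mat t)"

definition lie_algebra :: "('a::rch^'n^'n) set \<Rightarrow> ('a^'n^'n) set"
  where "lie_algebra G = {X. \<forall>s::real. mexp (s *\<^sub>R X) \<in> G}"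

text \<open>Linear functionals on \<open>\<aa> = range H_mat\<close> are given in the coordinates \<open>t\<close>.\<close>

definition root_space :: "(real^'q \<Rightarrow> real) \<Rightarrow> ('a::rch, 'q::finite, 'r::finite) gmat set"
  where "root_space \<alpha> =
    {X \<in> lie_algebra grp_G. \<forall>t. H_mat t ** X - X ** H_mat t = \<alpha> t *\<^sub>R X}"

definition pos_roots :: "(real^('q::{finite,linorder}) \<Rightarrow> real) set"
  where "pos_roots =
    {(\<lambda>t. t $ i) |i. True} \<union> {(\<lambda>t. 2 * t $ i) |i. True} \<union>
    {(\<lambda>t. t $ i - t $ j) |i j. i < j} \<union> {(\<lambda>t. t $ i + t $ j) |i j. i < j}"

definition nilp_n :: "('a::rch, 'q::{finite,linorder}, 'r::finite) gmat set"
  where "nilp_n = span (\<Union>\<alpha>\<in>pos_roots. root_space \<alpha>)"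

definition grp_N :: "('a::rch, 'q::{finite,linorder}, 'r::finite) gmat set"
  where "grp_N = mexp ` nilp_n"

text \<open>The \<open>\<aa>\<close>-component of the Iwasawa decomposition: \<open>H(g)\<close> is \<open>H_mat (iwasawa g)\<close>.\<close>

definition iwasawa :: "('a::rch, 'q::{finite,linorder}, 'r::finite) gmat \<Rightarrow> real^('q::{finite,linorder})"
  where "iwasawa g = (THE t. \<exists>k\<in>grp_K. \<exists>n\<in>grp_N. g = k ** mexp (H_mat t) ** n)"

text \<open>\<open>\<rho>\<^sup>B\<^sup>C\<close> in terms of \<open>d\<close> and \<open>p\<close>; the position of \<open>i\<close> in \<open>1, \<dots>, q\<close> is \<open>card {..i}\<close>.\<close>

definition rhoBC :: "nat \<Rightarrow> nat \<Rightarrow> complex^('q::{finite,linorder})"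
  where "rhoBC d p = (\<chi> i. of_real
    (real d / 2 * (real p + real CARD('q) + 2 - 2 * real (card {..i})) - 1))"

definition pairing :: "complex^'q \<Rightarrow> real^'q \<Rightarrow> complex"
  where "pairing lam t = (\<Sum>r\<in>UNIV. lam $ r * of_real (t $ r))"

definition spherical_fun ::
    "('a::rch, 'q::{finite,linorder}, 'r::finite) gmat measure \<Rightarrow> complex^('q::{finite,linorder}) \<Rightarrow>
      ('a, 'q, 'r) gmat \<Rightarrow> complex"
  where "spherical_fun dk lam g =
    (\<integral>k. exp (pairing (\<i> *s lam - rhoBC DIM('a) CARD('q + 'r)) (iwasawa (g ** k))) \<partial>dk)"

definition sigma0 :: "'a::rch^'q^('q::finite + 'r::finite)"
  where "sigma0 = (\<chi> i j. case i of Inl k \<Rightarrow> (if k = j then 1 else 0) | Inr _ \<Rightarrow> 0)"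

definition upper_block :: "'a::rch^('q::finite + 'p::finite)^('q + 'p) \<Rightarrow> 'a^'q^'q"
  where "upper_block k = (\<chi> i j. k $ Inl i $ Inl j)"

definition lower_block :: "'a::rch^('q::finite + 'p::finite)^('q + 'p) \<Rightarrow> 'a^'p^'p"
  where "lower_block k = (\<chi> i j. k $ Inr i $ Inr j)"

definition x_mat :: "real^'q \<Rightarrow> ('a::rch, 'q::finite, 'r::finite) gmat \<Rightarrow> 'a^'q^'q"
  where "x_mat t k =
    (let y = diag (\<chi> i. cosh (t $ i)) ** upper_block k
           + diag (\<chi> i. sinh (t $ i)) ** (adj sigma0 ** lower_block k ** sigma0)
     in adj y ** y)"

end

theory Submission
  imports Defs
begin

text \<open>
  The two integrands agree at every point of \<open>K\<close>: for \<open>k\<close> in \<open>K\<close> and every \<open>\<mu>\<close>,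
  \<open>\<Delta>\<^sub>\<mu>\<^sub>/\<^sub>2(x\<^sub>t(k)) = exp (\<mu>(H(a\<^sub>t k)))\<close>. This is because the Iwasawa projection of \<open>g = a\<^sub>t k\<close> can be read off
  from principal minors. The vectors \<open>b\<^sub>j = e\<^sub>j + e\<^sub>q\<^sub>+\<^sub>j\<close> are eigenvectors of \<open>\<aa>\<close> with weights \<open>t\<^sub>j\<close>, the highest ones,
  and the group \<open>N\<close> acts on their span by upper unitriangular matrices. If \<open>g = k' a\<^sub>s n\<close>, then the first \<open>q\<close> rows of
  \<open>g b\<^sub>1, \<dots>, g b\<^sub>q\<close> form the matrix \<open>u' exp (s) T\<close>, with \<open>u'\<close> the unitary top block of \<open>k'\<close> and \<open>T\<close> unitriangular. Computed
  directly from \<open>a\<^sub>t k\<close>, the same matrix is \<open>y = cosh t u + sinh t \<sigma>\<^sub>0\<^sup>* v \<sigma>\<^sub>0\<close>. Hence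
  \<open>x\<^sub>t(k) = y\<^sup>* y = T\<^sup>* exp (2 s) T\<close>, and its \<open>r\<close>-th principal minor is \<open>exp (2 (s\<^sub>1 + \<dots> + s\<^sub>r))\<close>
  (\<open>minor_x_mat_of_iwasawa\<close>). Summation by parts turns the product of powers of minors into \<open>exp (\<mu>(s))\<close>
  (\<open>power_fun_x_mat\<close>). The minors also determine \<open>s\<close>, which gives the uniqueness that the definition of
  \<open>iwasawa\<close> asks for.

  The larger part of the work is existence of the decomposition (\<open>iwasawa_exists\<close>), for groups \<open>K\<close>
  and \<open>N\<close> that are given by conditions on blocks, determinants and root spaces. The matrix \<open>y\<close> is invertible because the \<open>b\<^sub>j\<close>
  span an isotropic subspace, and Gram--Schmidt applied to its columns yields \<open>u'\<close>, \<open>s\<close> and \<open>T\<^sup>-\<^sup>1\<close>; the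
  rest of \<open>k'\<close> follows from the invariance of the form. What remains is an isometry that is unipotent in the basis of weight
  vectors. To see that it lies in \<open>N = exp \<nn>\<close> (\<open>unipotent_inverse_in_grp_N\<close>), its logarithm is taken as a
  polynomial. That the logarithm is skew for the form follows from injectivity of the exponential on nilpotent matrices, and skewness
  passes to the components in the root spaces. Each component exponentiates into the identity component of the isometry group,
  since unipotent matrices have determinant 1.

  Determinants over the quaternions are handled through complex matrices of twice the size. Two devices make the
  three algebras look alike: a principal minor is the determinant of a matrix completed by the identity (\<open>mask\<close>), and
  triangularity is expressed by a grading of the index type (\<open>raises\<close>), which makes sense on the doubled index type as well.
\<close>

section \<open>Scalars and conjugate transposes\<close>

lemma quat_of_0 [simp]: "quat_of 0 = 0"
  by (metis norm_eq_zero norm_quat_of norm_zero)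

lemma linear_quat_of: "linear quat_of"
  by (simp add: linear_iff quat_of_add quat_of_scaleR)

lemma quat_of_eq_iff: "quat_of x = quat_of y \<longleftrightarrow> x = y"
proof -
  have "norm (quat_of x - quat_of y) = norm (x - y)"
    by (simp add: linear_diff[OF linear_quat_of, symmetric] norm_quat_of)
  then show ?thesis
    by (metis norm_eq_zero right_minus_eq)
qed

lemma inj_quat_of: "inj quat_of"
  by (simp add: inj_def quat_of_eq_iff)

lemma qcnj_simps [simp]:
  "qcnj (x + y) = qcnj x + qcnj y" "qcnj (x * y) = qcnj y * qcnj x" "qcnj (qcnj x) = x"
  "qcnj 0 = 0" "qcnj 1 = 1" "qcnj (r *\<^sub>R x) = r *\<^sub>R qcnj x"
  by (simp_all add: qcnj_def quat_eq_iff plus_quat_def times_quat_def scaleR_quat_def zero_quat_def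
      one_quat_def)

lemma quat_of_of_real: "quat_of (of_real r) = of_real r"
  by (simp add: of_real_def quat_of_scaleR quat_of_1)

lemma conj_add [simp]: "conj (x + y) = conj x + conj y"
  by (simp add: quat_of_eq_iff[symmetric] quat_of_conj quat_of_add)

lemma conj_mult [simp]: "conj (x * y) = conj y * conj x"
  by (simp add: quat_of_eq_iff[symmetric] quat_of_conj quat_of_mult)

lemma conj_conj [simp]: "conj (conj x) = x"
  by (simp add: quat_of_eq_iff[symmetric] quat_of_conj)

lemma conj_0 [simp]: "conj 0 = 0" and conj_1 [simp]: "conj 1 = 1"
  by (simp_all add: quat_of_eq_iff[symmetric] quat_of_conj quat_of_1)

lemma conj_scaleR [simp]: "conj (r *\<^sub>R x) = r *\<^sub>R conj x"
  by (simp add: quat_of_eq_iff[symmetric] quat_of_conj quat_of_scaleR)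

lemma conj_of_real [simp]: "conj (of_real r) = of_real r"
  by (simp add: of_real_def)

lemma conj_eq_0_iff [simp]: "conj x = 0 \<longleftrightarrow> x = 0"
  by (metis conj_conj conj_0)

lemma conj_minus [simp]: "conj (- x) = - conj x"
  using conj_scaleR[of "-1" x] by simp

lemma conj_sum: "conj (sum f A) = (\<Sum>i\<in>A. conj (f i))"
  by (induction A rule: infinite_finite_induct) auto

lemma inner_quat_of: "inner (quat_of x) (quat_of y) = inner x y"
proof -
  have "inner (quat_of x) (quat_of y) =
      ((norm (quat_of (x + y)))\<^sup>2 - (norm (quat_of x))\<^sup>2 - (norm (quat_of y))\<^sup>2) / 2"
    by (simp add: power2_norm_eq_inner inner_add inner_commute quat_of_add)
  also have "\<dots> = inner x y"
    unfolding norm_quat_of by (simp add: power2_norm_eq_inner inner_add inner_commute)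
  finally show ?thesis .
qed

text \<open>
  The real inner product is the real part of \<open>conj x * y\<close>. This law makes \<open>adj\<close> the adjoint for the
  real inner product on column vectors, so that the theory of real Euclidean spaces can be applied to
  matrices over the quaternions.
\<close>

lemma inner_mult_left_conj: "inner (a * x) y = inner x (conj a * y)"
proof -
  have "inner (quat_of a * quat_of x) (quat_of y) = inner (quat_of x) (qcnj (quat_of a) * quat_of y)"
    by (simp add: inner_quat_def times_quat_def qcnj_def algebra_simps)
  then show ?thesis
    by (simp flip: quat_of_mult quat_of_conj add: inner_quat_of)
qed

lemma conj_mult_self: "conj (x :: 'a::rch) * x = of_real ((norm x)\<^sup>2)"
proof -
  have "quat_of (conj x * x) = of_real ((norm (quat_of x))\<^sup>2)"
    unfolding quat_of_mult quat_of_conj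
    by (simp add: of_real_quat power2_norm_eq_inner inner_quat_def qcnj_def times_quat_def del: of_real_power)
  then show ?thesis
    unfolding norm_quat_of quat_of_of_real[symmetric, where 'a='a] by (simp only: quat_of_eq_iff)
qed

lemma adj_nth [simp]: "adj A $ i $ j = conj (A $ j $ i)"
  by (simp add: adj_def)

lemma adj_adj [simp]: "adj (adj A) = A"
  by (simp add: vec_eq_iff)

lemma adj_add [simp]: "adj (A + B) = adj A + adj B"
  by (simp add: vec_eq_iff)

lemma adj_scaleR [simp]: "adj (r *\<^sub>R A) = r *\<^sub>R adj A"
  by (simp add: vec_eq_iff)

lemma adj_0 [simp]: "adj 0 = 0"
  by (simp add: vec_eq_iff)

lemma adj_mult [simp]: "adj (A ** B) = adj B ** adj A"
  by (simp add: vec_eq_iff matrix_matrix_mult_def conj_sum)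

lemma adj_mat_1 [simp]: "adj (mat 1) = mat 1"
  by (auto simp: vec_eq_iff mat_def)

lemma linear_adj: "linear adj"
  by (simp add: linear_iff)

lemma adj_diag [simp]: "adj (diag s) = diag s"
  by (auto simp: vec_eq_iff diag_def)

lemma inner_matrix_vector_adj: "inner (A *v x) y = inner x (adj A *v y)"
  by (simp add: inner_vec_def matrix_vector_mult_def inner_sum_left inner_sum_right inner_mult_left_conj)
     (rule sum.swap)

text \<open>
  Over a division algebra that need not be commutative, injectivity and surjectivity are compared through
  the real dimension.
\<close>

lemma matrix_left_inverse_imp_right:
  fixes A B :: "'a::rch^'n^'n"
  assumes "B ** A = mat 1"
  shows "A ** B = mat 1"
proof -
  have "inj ((*v) A)"
    by (rule inj_on_inverseI[where g="(*v) B"]) (simp add: matrix_vector_mul_assoc assms)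
  then have s: "surj ((*v) A)"
    using linear_injective_imp_surjective[OF matrix_vector_mul_linear] by blast
  have "(A ** B) *v x = mat 1 *v x" for x
  proof -
    obtain z where "x = A *v z" using s by blast
    then have "(A ** B) *v x = A *v ((B ** A) *v z)" by (simp add: matrix_vector_mul_assoc matrix_mul_assoc)
    then show ?thesis by (simp add: assms \<open>x = A *v z\<close>)
  qed
  then show ?thesis by (simp add: matrix_eq)
qed

lemma matrix_uminus_left [simp]: "(- A) ** (B :: 'a::ring_1^'n^'m) = - (A ** B)"
  by (simp add: vec_eq_iff matrix_matrix_mult_def sum_negf)

lemma matrix_uminus_right [simp]: "A ** (- B :: 'a::ring_1^'n^'m) = - (A ** B)"
  by (simp add: vec_eq_iff matrix_matrix_mult_def sum_negf)

lemma matrix_scaleR_left [simp]: "(r *\<^sub>R A) ** (B :: 'a::real_algebra_1^'n^'m) = r *\<^sub>R (A ** B)"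
  by (simp add: vec_eq_iff matrix_matrix_mult_def scaleR_sum_right)

lemma matrix_scaleR_right [simp]: "A ** (r *\<^sub>R B :: 'a::real_algebra_1^'n^'m) = r *\<^sub>R (A ** B)"
  by (simp add: vec_eq_iff matrix_matrix_mult_def scaleR_sum_right)

lemma linear_matrix_mult_left: "linear (\<lambda>X :: 'a::real_algebra_1^'n^'m. A ** X)"
  by (simp add: linear_iff matrix_add_ldistrib)

lemma matrix_add_rdistrib: "(A + B) ** C = A ** C + B ** C"
  by (simp add: vec_eq_iff matrix_matrix_mult_def distrib_right sum.distrib)

lemma linear_matrix_mult_right: "linear (\<lambda>X :: 'a::real_algebra_1^'n^'m. X ** A)"
  by (simp add: linear_iff matrix_add_rdistrib)

lemma diag_mult_nth [simp]: "(diag s ** A) $ i $ j = of_real (s $ i) * A $ i $ j"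
  by (simp add: matrix_matrix_mult_def diag_def if_distrib if_distribR cong: if_cong)

lemma mult_diag_nth [simp]: "(A ** diag s) $ i $ j = A $ i $ j * of_real (s $ j)"
  by (simp add: matrix_matrix_mult_def diag_def if_distrib if_distribR cong: if_cong)

lemma diag_1: "diag (\<chi> i. 1) = mat 1"
  by (simp add: vec_eq_iff diag_def mat_def)

lemma diag_mult_diag: "diag s ** diag t = (diag (\<chi> i. s $ i * t $ i) :: 'a::rch^'n^'n)"
  by (simp add: vec_eq_iff) (simp add: diag_def)

section \<open>Determinants and principal minors\<close>

lemma DIM_eq_dim_range: "dim (range (quat_of :: 'a::rch \<Rightarrow> quat)) = DIM('a)"
  using dim_image_eq[OF linear_quat_of, of "UNIV :: 'a set"] inj_quat_of by simp

lemma dim_range_complex: "dim (range complex_to_quat) = 2"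
  using dim_image_eq[of complex_to_quat UNIV]
  by (simp add: linear_iff inj_def complex_to_quat_def plus_quat_def scaleR_quat_def complex_eq_iff)

text \<open>
  The condition on the range of \<open>quat_of\<close> turns the real dimension of the scalars into the
  algebra itself: outside dimension 4 the \<open>j\<close>-part vanishes, so \<open>cpart1\<close> is multiplicative there.
\<close>

lemma cpart2_eq_0:
  assumes "DIM('a::rch) \<noteq> 4"
  shows "cpart2 (x :: 'a) = 0"
proof -
  have "range (quat_of :: 'a \<Rightarrow> quat) \<noteq> UNIV"
    using assms DIM_eq_dim_range[where 'a='a] by auto
  then have "quat_of x \<in> range of_real \<union> range complex_to_quat"
    using range_quat_of[where 'a='a] by (metis UnI1 UnI2 emptyE insertE rangeI)
  then show ?thesis
    by (auto simp: cpart2_def of_real_quat complex_to_quat_def zero_complex.code)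
qed

lemma cpart1_Reals:
  assumes "DIM('a::rch) = 1"
  shows "cpart1 (x :: 'a) \<in> \<real>"
proof -
  have "range (quat_of :: 'a \<Rightarrow> quat) = range of_real"
    using assms DIM_eq_dim_range[where 'a='a] range_quat_of[where 'a='a] dim_range_complex by auto
  then have "quat_of x \<in> range of_real"
    by auto
  then show ?thesis
    by (auto simp: cpart1_def of_real_quat complex_is_Real_iff)
qed

lemma cpart1_add: "cpart1 (x + y) = cpart1 x + cpart1 y"
  by (simp add: cpart1_def quat_of_add plus_quat_def complex_eq_iff)

lemma cpart2_add: "cpart2 (x + y) = cpart2 x + cpart2 y"
  by (simp add: cpart2_def quat_of_add plus_quat_def complex_eq_iff)

lemma cpart1_of_real [simp]: "cpart1 (of_real r) = of_real r"
  by (simp add: cpart1_def quat_of_of_real of_real_quat complex_eq_iff)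

lemma cpart2_of_real [simp]: "cpart2 (of_real r) = 0"
  by (simp add: cpart2_def quat_of_of_real of_real_quat complex_eq_iff)

lemma cpart_0 [simp]: "cpart1 0 = 0" "cpart2 0 = 0"
  using cpart1_of_real[of 0] cpart2_of_real[of 0] by simp_all

lemma cpart_1 [simp]: "cpart1 1 = 1" "cpart2 1 = 0"
  using cpart1_of_real[of 1] cpart2_of_real[of 1] by simp_all

lemma cpart1_sum: "cpart1 (sum f S) = (\<Sum>i\<in>S. cpart1 (f i))"
  by (induction S rule: infinite_finite_induct) (simp_all add: cpart1_add)

lemma cpart2_sum: "cpart2 (sum f S) = (\<Sum>i\<in>S. cpart2 (f i))"
  by (induction S rule: infinite_finite_induct) (simp_all add: cpart2_add)

lemma cpart1_mult: "cpart1 (x * y) = cpart1 x * cpart1 y - cpart2 x * cnj (cpart2 y)"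
  by (simp add: cpart1_def cpart2_def quat_of_mult times_quat_def complex_eq_iff)

lemma cpart2_mult: "cpart2 (x * y) = cpart1 x * cpart2 y + cpart2 x * cnj (cpart1 y)"
  by (simp add: cpart1_def cpart2_def quat_of_mult times_quat_def complex_eq_iff)

lemma sum_UNIV_sum:
  "(\<Sum>i\<in>(UNIV :: ('n::finite + 'm::finite) set). f i) = (\<Sum>i\<in>UNIV. f (Inl i)) + (\<Sum>i\<in>UNIV. f (Inr i))"
  using sum.Plus[of UNIV UNIV f] by simp

lemma prod_UNIV_sum:
  "(\<Prod>i\<in>(UNIV :: ('n::finite + 'm::finite) set). f i) = (\<Prod>i\<in>UNIV. f (Inl i)) * (\<Prod>i\<in>UNIV. f (Inr i))"
  using prod.Plus[of UNIV UNIV f] by simp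

lemma all_sum_type: "(\<forall>i :: 'n + 'm. P i) \<longleftrightarrow> (\<forall>i. P (Inl i)) \<and> (\<forall>i. P (Inr i))"
  by (metis sum.exhaust)

lemma complexify_mult: "complexify (A ** B) = complexify A ** complexify B"
  by (simp add: vec_eq_iff all_sum_type complexify_def matrix_matrix_mult_def sum_UNIV_sum
      cpart1_sum cpart2_sum cpart1_mult cpart2_mult sum_subtractf sum.distrib sum_negf)

definition cmatrix :: "'a::rch^'n^'m \<Rightarrow> complex^'n^'m"
  where "cmatrix A = (\<chi> i j. cpart1 (A $ i $ j))"

lemma cmatrix_mult:
  assumes "DIM('a::rch) \<noteq> 4"
  shows "cmatrix ((A :: 'a^'n^'m) ** B) = cmatrix A ** cmatrix B"
  by (simp add: vec_eq_iff cmatrix_def matrix_matrix_mult_def cpart1_sum cpart1_mult cpart2_eq_0[OF assms])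

text \<open>
  The submatrix on \<open>S\<close> is completed by the identity, so that principal minors become determinants of
  matrices of full size and inherit multiplicativity from them.
\<close>

definition mask :: "'n set \<Rightarrow> 'b::{zero,one}^'n^'n \<Rightarrow> 'b^'n^'n"
  where "mask S A = (\<chi> i j. if i \<in> S \<and> j \<in> S then A $ i $ j else mat 1 $ i $ j)"

text \<open>
  A permutation that moves an index outside \<open>S\<close> meets a zero entry of the masked matrix.
\<close>

lemma det_on_eq_det_mask: "det_on S (A :: 'b::comm_ring_1^'n^'n) = det (mask S A)"
proof -
  have "det (mask S A) = (\<Sum>\<pi> | \<pi> permutes S. of_int (sign \<pi>) * (\<Prod>i\<in>UNIV. mask S A $ i $ \<pi> i))"
    unfolding det_def
  proof (rule sum.mono_neutral_right)
    show "{\<pi>. \<pi> permutes S} \<subseteq> {\<pi>. \<pi> permutes UNIV}"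
      using permutes_subset by blast
    show "\<forall>\<pi>\<in>{\<pi>. \<pi> permutes UNIV} - {\<pi>. \<pi> permutes S}.
        of_int (sign \<pi>) * (\<Prod>i\<in>UNIV. mask S A $ i $ \<pi> i) = 0"
    proof
      fix \<pi> :: "'n \<Rightarrow> 'n" assume \<pi>: "\<pi> \<in> {\<pi>. \<pi> permutes UNIV} - {\<pi>. \<pi> permutes S}"
      then obtain i where "i \<notin> S" "\<pi> i \<noteq> i"
        unfolding permutes_def by auto
      then have "mask S A $ i $ \<pi> i = 0" by (simp add: mask_def mat_def)
      then have "(\<Prod>i\<in>UNIV. mask S A $ i $ \<pi> i) = 0"
        using prod_zero[of UNIV "\<lambda>i. mask S A $ i $ \<pi> i"] by auto
      then show "of_int (sign \<pi>) * (\<Prod>i\<in>UNIV. mask S A $ i $ \<pi> i) = 0" by simp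
    qed
  qed simp
  also have "\<dots> = det_on S A"
    unfolding det_on_def
  proof (rule sum.cong)
    fix \<pi> assume "\<pi> \<in> {\<pi>. \<pi> permutes S}"
    then have \<pi>: "\<pi> permutes S" by simp
    have "(\<Prod>i\<in>UNIV. mask S A $ i $ \<pi> i) = (\<Prod>i\<in>S. mask S A $ i $ \<pi> i)"
      using \<pi> by (intro prod.mono_neutral_right) (auto simp: mask_def mat_def permutes_def)
    also have "\<dots> = (\<Prod>i\<in>S. A $ i $ \<pi> i)"
      using \<pi> by (intro prod.cong) (auto simp: mask_def permutes_in_image)
    finally show "of_int (sign \<pi>) * (\<Prod>i\<in>UNIV. mask S A $ i $ \<pi> i) =
        of_int (sign \<pi>) * (\<Prod>i\<in>S. A $ i $ \<pi> i)" by simp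
  qed simp
  finally show ?thesis ..
qed

text \<open>
  The permutations of the range are the permutations of the index type transported along \<open>f\<close>, with the same signs.
\<close>

lemma det_on_range:
  fixes f :: "'m::finite \<Rightarrow> 'n::finite"
  assumes "inj f"
  shows "det_on (range f) A = det (\<chi> i j. A $ f i $ f j)"
proof -
  have bij: "bij_betw f UNIV (range f)" using assms by (simp add: bij_betw_def)
  have "bij_betw (map_permutation UNIV f) {\<pi>. \<pi> permutes UNIV} {\<pi>. \<pi> permutes range f}"
  proof (rule bij_betw_byWitness[where f'="map_permutation (range f) (inv f)"])
    show "\<forall>\<pi>\<in>{\<pi>. \<pi> permutes UNIV}. map_permutation (range f) (inv f) (map_permutation UNIV f \<pi>) = \<pi>"
      using map_permutation_compose_inv[OF bij] assms by simp
    show "\<forall>\<pi>\<in>{\<pi>. \<pi> permutes range f}. map_permutation UNIV f (map_permutation (range f) (inv f) \<pi>) = \<pi>"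
    proof
      fix \<pi> assume "\<pi> \<in> {\<pi>. \<pi> permutes range f}"
      then have "\<pi> permutes range f" by simp
      then show "map_permutation UNIV f (map_permutation (range f) (inv f) \<pi>) = \<pi>"
        by (rule map_permutation_compose_inv[OF bij_betw_inv_into[OF bij]])
           (auto simp: f_inv_into_f)
    qed
    show "map_permutation UNIV f ` {\<pi>. \<pi> permutes UNIV} \<subseteq> {\<pi>. \<pi> permutes range f}"
      using map_permutation_permutes[OF bij] by auto
    show "map_permutation (range f) (inv f) ` {\<pi>. \<pi> permutes range f} \<subseteq> {\<pi>. \<pi> permutes UNIV}"
      using map_permutation_permutes[OF bij_betw_inv_into[OF bij]] by auto
  qed
  then have "det_on (range f) A = (\<Sum>\<pi> | \<pi> permutes UNIV.
      of_int (sign (map_permutation UNIV f \<pi>)) * (\<Prod>i\<in>range f. A $ i $ map_permutation UNIV f \<pi> i))"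
    unfolding det_on_def by (rule sum.reindex_bij_betw[symmetric])
  also have "\<dots> = det (\<chi> i j. A $ f i $ f j)"
    unfolding det_def
    by (rule sum.cong)
       (simp_all add: sign_map_permutation assms prod.reindex map_permutation_apply)
  finally show ?thesis .
qed

text \<open>
  With basis vectors graded by \<open>lv\<close>, such a matrix maps each basis vector into the span of basis vectors
  of strictly larger degree. This expresses strict triangularity for index types that carry no order, such as the sum
  types on which the group acts.
\<close>

definition raises :: "('n \<Rightarrow> int) \<Rightarrow> 'b::zero^'n^'n \<Rightarrow> bool"
  where "raises lv X \<longleftrightarrow> (\<forall>i j. X $ i $ j \<noteq> 0 \<longrightarrow> lv j < lv i)"

lemma unipotent_nth:
  fixes A :: "'b::ring_1^'n^'n"
  assumes "raises lv (A - mat 1)" "\<not> lv j < lv i"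
  shows "A $ i $ j = (if i = j then 1 else 0)"
proof -
  have "(A - mat 1) $ i $ j = 0"
    using assms by (auto simp: raises_def)
  then show ?thesis by (simp add: mat_def)
qed

text \<open>
  A permutation \<open>\<pi>\<close> with nonzero product satisfies \<open>lv (\<pi> i) \<le> lv i\<close> for all \<open>i\<close>; since
  \<open>\<pi>\<close> preserves the sum of all degrees, equality holds throughout and \<open>\<pi>\<close> is the identity.
\<close>

lemma det_unipotent:
  fixes A :: "'b::comm_ring_1^'n^'n"
  assumes "raises lv (A - mat 1)"
  shows "det A = 1"
proof -
  have off: "A $ i $ j = 0" if "i \<noteq> j" "\<not> lv j < lv i" for i j
    using unipotent_nth[OF assms] that by simp
  have on: "A $ i $ i = 1" for i
    using unipotent_nth[OF assms] by simp
  have "of_int (sign \<pi>) * (\<Prod>i\<in>UNIV. A $ i $ \<pi> i) = 0" if \<pi>: "\<pi> permutes UNIV" "\<pi> \<noteq> id" for \<pi>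
  proof -
    have "\<exists>i. \<pi> i \<noteq> i \<and> \<not> lv (\<pi> i) < lv i"
    proof (rule ccontr)
      assume "\<not> ?thesis"
      then have le: "lv (\<pi> i) \<le> lv i" and neq: "\<pi> i \<noteq> i \<Longrightarrow> lv (\<pi> i) < lv i" for i
        by (metis linorder_not_less order_refl order_less_imp_le, blast)
      have "(\<Sum>i\<in>UNIV. lv (\<pi> i)) = (\<Sum>i\<in>UNIV. lv i)"
        using sum.permute[OF \<pi>(1), of lv] by simp
      moreover obtain i where "\<pi> i \<noteq> i" using \<pi>(2) by (auto simp: fun_eq_iff)
      ultimately show False
        using sum_strict_mono_ex1[of UNIV "\<lambda>i. lv (\<pi> i)" lv] le neq by auto
    qed
    then obtain i where "A $ i $ \<pi> i = 0" using off by metis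
    then have "(\<Prod>i\<in>UNIV. A $ i $ \<pi> i) = 0"
      using prod_zero[of UNIV "\<lambda>i. A $ i $ \<pi> i"] by auto
    then show ?thesis by simp
  qed
  then have "det A = (\<Sum>\<pi>\<in>{id}. of_int (sign \<pi>) * (\<Prod>i\<in>UNIV. A $ i $ \<pi> i))"
    unfolding det_def by (intro sum.mono_neutral_right) (auto simp: permutes_id)
  then show ?thesis by (simp add: on)
qed

text \<open>
  The principal minor before the square root is taken over the quaternions. On full matrices it is multiplicative
  over all three algebras, whereas \<open>csqrt\<close> is not multiplicative on arbitrary complex numbers.
\<close>

definition cdet :: "'n set \<Rightarrow> 'a::rch^'n^'n \<Rightarrow> complex"
  where "cdet S A = (if DIM('a) = 4 then det_on (S <+> S) (complexify A) else det_on S (cmatrix A))"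

lemma minor_eq_cdet:
  "minor S (A :: 'a::rch^'n^'n) = (if DIM('a) = 4 then csqrt (cdet S A) else cdet S A)"
  by (simp add: minor_def cdet_def cmatrix_def)

lemma complexify_mask: "complexify (mask S A) = mask (S <+> S) (complexify A)"
  by (auto simp: vec_eq_iff all_sum_type complexify_def mask_def mat_def)

lemma cmatrix_mask: "cmatrix (mask S A) = mask S (cmatrix A)"
  by (auto simp: vec_eq_iff cmatrix_def mask_def mat_def)

lemma mask_UNIV [simp]: "mask UNIV A = A"
  by (simp add: vec_eq_iff mask_def)

lemma cdet_eq_mask: "cdet S A = cdet UNIV (mask S A)"
  by (simp add: cdet_def det_on_eq_det_mask complexify_mask cmatrix_mask)

lemma cdet_mult: "cdet UNIV (A ** B) = cdet UNIV A * cdet UNIV (B :: 'a::rch^'n^'n)"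
  by (simp add: cdet_def det_on_UNIV complexify_mult cmatrix_mult det_mul)

lemma cdet_unipotent:
  assumes "raises lv (A - mat 1)"
  shows "cdet UNIV A = 1"
proof -
  have a: "A $ i $ j = (if i = j then 1 else 0)" if "\<not> lv j < lv i" for i j
    using unipotent_nth[OF assms that] .
  have "raises (case_sum lv lv) (complexify A - mat 1)"
    by (auto simp: raises_def all_sum_type complexify_def mat_def; rule ccontr; simp add: a split: if_splits)
  moreover have "raises lv (cmatrix A - mat 1)"
    by (auto simp: raises_def cmatrix_def mat_def; rule ccontr; simp add: a)
  ultimately show ?thesis
    by (simp add: cdet_def det_on_UNIV det_unipotent)
qed

lemma cdet_1 [simp]: "cdet UNIV (mat 1 :: 'a::rch^'n^'n) = 1"
  by (rule cdet_unipotent[of "\<lambda>_. 0"]) (simp add: raises_def)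

lemma cdet_diag:
  "cdet UNIV (diag s :: 'a::rch^'n^'n) = of_real ((\<Prod>i\<in>UNIV. s $ i) ^ (if DIM('a) = 4 then 2 else 1))"
proof -
  have "det (complexify (diag s :: 'a^'n^'n)) = of_real ((\<Prod>i\<in>UNIV. s $ i)\<^sup>2)"
    by (subst det_diagonal)
       (auto simp: complexify_def diag_def prod_UNIV_sum power2_eq_square split: sum.split)
  moreover have "det (cmatrix (diag s :: 'a^'n^'n)) = of_real (\<Prod>i\<in>UNIV. s $ i)"
    by (subst det_diagonal) (auto simp: cmatrix_def diag_def)
  ultimately show ?thesis
    by (simp add: cdet_def det_on_UNIV)
qed

text \<open>
  The hypothesis says that no path from \<open>S\<close> to \<open>S\<close> leaves \<open>S\<close> in between, as happens for an upper
  triangular right factor and an initial segment \<open>S\<close>.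
\<close>

lemma mask_mult:
  fixes A B :: "'b::semiring_1^'n^'n"
  assumes "\<And>i k j. i \<in> S \<Longrightarrow> j \<in> S \<Longrightarrow> k \<notin> S \<Longrightarrow> A $ i $ k * B $ k $ j = 0"
  shows "mask S (A ** B) = mask S A ** mask S B"
proof -
  have "(mask S A ** mask S B) $ i $ j = mask S (A ** B) $ i $ j" for i j
  proof (cases "i \<in> S")
    case True
    have "(mask S A ** mask S B) $ i $ j = (\<Sum>k\<in>S. A $ i $ k * mask S B $ k $ j)"
      unfolding matrix_matrix_mult_def vec_lambda_beta
      by (rule sum.mono_neutral_cong_right) (use True in \<open>auto simp: mask_def mat_def\<close>)
    also have "\<dots> = mask S (A ** B) $ i $ j"
    proof (cases "j \<in> S")
      case j: True
      have "(\<Sum>k\<in>S. A $ i $ k * mask S B $ k $ j) = (\<Sum>k\<in>UNIV. A $ i $ k * B $ k $ j)"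
        by (rule sum.mono_neutral_cong_left) (use True j assms in \<open>auto simp: mask_def\<close>)
      then show ?thesis
        using True j by (simp add: mask_def matrix_matrix_mult_def)
    next
      case False
      with True show ?thesis
        by (auto simp: mask_def mat_def intro!: sum.neutral)
    qed
    finally show ?thesis .
  next
    case False
    then have "(mask S A ** mask S B) $ i $ j = (\<Sum>k\<in>UNIV. mat 1 $ i $ k * mask S B $ k $ j)"
      by (simp add: matrix_matrix_mult_def mask_def)
    also have "\<dots> = (mat 1 ** mask S B) $ i $ j"
      by (simp add: matrix_matrix_mult_def)
    finally show ?thesis
      using False by (simp add: mask_def)
  qed
  then show ?thesis by (simp add: vec_eq_iff)
qed

lemma mask_diag: "mask S (diag s :: 'a::rch^'n^'n) = diag (\<chi> i. if i \<in> S then s $ i else 1)"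
  by (auto simp: vec_eq_iff mask_def diag_def mat_def)

text \<open>
  Counted from the top of the order, so that a strictly upper triangular matrix raises the height.
\<close>

definition height :: "'q::{finite,linorder} \<Rightarrow> int"
  where "height i = int (card {i..})"

lemma height_less_iff [simp]: "height j < height i \<longleftrightarrow> i < j"
proof -
  have "height j < height i" if "i < j" for i j :: 'a
    using that unfolding height_def by (auto intro!: psubset_card_mono)
  then show ?thesis
    by (metis linorder_cases order_less_asym less_irrefl)
qed

lemma height_pos: "0 < height i"
  by (auto simp: height_def card_gt_0_iff)

lemma cdet_adj_unipotent:
  fixes T :: "'a::rch^'n^'n"
  assumes "raises lv (T - mat 1)"
  shows "cdet UNIV (adj T) = 1"
proof (rule cdet_unipotent)
  show "raises (\<lambda>i. - lv i) (adj T - mat 1)"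
    unfolding raises_def
  proof (intro allI impI)
    fix i j assume "(adj T - mat 1) $ i $ j \<noteq> 0"
    then have "(T - mat 1) $ j $ i \<noteq> 0" by (auto simp: mat_def split: if_splits)
    then show "- lv j < - lv i" using assms by (auto simp: raises_def)
  qed
qed

text \<open>
  The leading block of \<open>T\<^sup>* D T\<close> is built from the leading blocks of the factors, and the two unitriangular ones
  have determinant 1. Over the quaternions \<open>cdet\<close> is the square of the product, and positivity of
  \<open>d\<close> makes \<open>csqrt\<close> return the product itself.
\<close>

lemma minor_gram_triangular:
  fixes T :: "'a::rch^('q::{finite,linorder})^('q::{finite,linorder})"
  assumes T: "raises height (T - mat 1)" and d: "\<And>i. 0 < d $ i"
  shows "minor {..r} (adj T ** diag d ** T) = of_real (\<Prod>i\<le>r. d $ i)"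
proof -
  let ?S = "{..r}"
  have T0: "T $ k $ j = 0" if "j \<in> ?S" "k \<notin> ?S" for j k
    using unipotent_nth[OF T, of j k] that by (auto split: if_splits)
  have Tm: "raises height (mask ?S T - mat 1)"
    using T by (auto simp: raises_def mask_def)
  have adjm: "mask ?S (adj T) = adj (mask ?S T)"
    by (auto simp: vec_eq_iff mask_def mat_def)
  have "mask ?S (adj T ** diag d ** T) = mask ?S (adj T) ** mask ?S (diag d) ** mask ?S T"
  proof -
    have "mask ?S (adj T ** diag d ** T) = mask ?S (adj T ** diag d) ** mask ?S T"
      by (rule mask_mult) (use T0 in \<open>simp del: mult_diag_nth\<close>)
    also have "mask ?S (adj T ** diag d) = mask ?S (adj T) ** mask ?S (diag d)"
      by (rule mask_mult) (auto simp: diag_def)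
    finally show ?thesis .
  qed
  then have "cdet ?S (adj T ** diag d ** T) = cdet UNIV (mask ?S (diag d) :: 'a^('q::{finite,linorder})^('q::{finite,linorder}))"
    by (subst cdet_eq_mask) (simp add: cdet_mult adjm cdet_unipotent[OF Tm] cdet_adj_unipotent[OF Tm])
  also have "\<dots> = of_real ((\<Prod>i\<le>r. d $ i) ^ (if DIM('a) = 4 then 2 else 1))"
  proof -
    have "(\<Prod>i\<in>UNIV. if i \<in> ?S then d $ i else 1) = (\<Prod>i\<le>r. d $ i)"
      by (rule prod.mono_neutral_cong_right) auto
    then show ?thesis by (simp add: mask_diag cdet_diag)
  qed
  finally have c: "cdet ?S (adj T ** diag d ** T) = of_real ((\<Prod>i\<le>r. d $ i) ^ (if DIM('a) = 4 then 2 else 1))" .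
  have "(\<Prod>i\<le>r. d $ i) > 0"
    using d by (simp add: prod_pos)
  then show ?thesis
    unfolding minor_eq_cdet c by (auto simp: csqrt_of_real_nonneg simp flip: of_real_power)
qed

text \<open>
  Each factor of \<open>block_diag u v = block_diag u (mat 1) ** block_diag (mat 1) v\<close> is a masked copy of the
  product, so its determinant is that of a diagonal block.
\<close>

lemma det_block_diag:
  fixes u :: "complex^('q::finite)^('q::finite)" and v :: "complex^('p::finite)^('p::finite)"
  shows "det (block_diag u v) = det u * det v"
proof -
  have "block_diag u v = block_diag u (mat 1) ** block_diag (mat 1) v"
    by (simp add: vec_eq_iff all_sum_type block_diag_def matrix_matrix_mult_def sum_UNIV_sum mat_def
        if_distrib if_distribR cong: if_cong)
  moreover have "block_diag u (mat 1) = mask (range Inl) (block_diag u v)"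
    by (auto simp: vec_eq_iff all_sum_type block_diag_def mask_def mat_def)
  moreover have "block_diag (mat 1) v = mask (range Inr) (block_diag u v)"
    by (auto simp: vec_eq_iff all_sum_type block_diag_def mask_def mat_def)
  ultimately have "det (block_diag u v) = det_on (range Inl) (block_diag u v) * det_on (range Inr) (block_diag u v)"
    by (metis det_mul det_on_eq_det_mask)
  also have "\<dots> = det u * det v"
    by (simp add: det_on_range block_diag_def)
  finally show ?thesis .
qed

lemma cdet_block_diag:
  assumes "DIM('a::rch) \<noteq> 4"
  shows "cdet UNIV (block_diag u v) = cdet UNIV u * cdet UNIV (v :: 'a^('p::finite)^('p::finite))"
proof -
  have "cmatrix (block_diag u v) = block_diag (cmatrix u) (cmatrix v)"
    by (simp add: vec_eq_iff all_sum_type block_diag_def cmatrix_def)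
  then show ?thesis
    using assms by (simp add: cdet_def det_on_UNIV det_block_diag)
qed

lemma cdet_Reals:
  assumes "DIM('a::rch) = 1"
  shows "cdet UNIV (A :: 'a^'n^'n) \<in> \<real>"
  using assms by (auto simp: cdet_def det_on_UNIV det_def cmatrix_def
      intro!: sum_in_Reals Reals_mult prod_in_Reals cpart1_Reals)

lemma linear_cpart1: "linear cpart1"
  by (simp add: linear_iff cpart1_add) (simp add: cpart1_def quat_of_scaleR scaleR_quat_def complex_eq_iff)

text \<open>
  Used for real scalars, to carry the sign of a determinant along a path.
\<close>

lemma continuous_on_cdet:
  fixes f :: "real \<Rightarrow> 'a::rch^'n^'n"
  assumes "DIM('a) \<noteq> 4" "\<And>i j. continuous_on S (\<lambda>c. f c $ i $ j)"
  shows "continuous_on S (\<lambda>c. cdet UNIV (f c))"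
proof -
  have "continuous_on S (\<lambda>c. cpart1 (f c $ i $ j))" for i j
    using linear_continuous_on_compose[OF assms(2) linear_cpart1] by simp
  then show ?thesis
    using assms(1) by (simp add: cdet_def det_on_UNIV det_def cmatrix_def)
      (intro continuous_intros continuous_on_sum continuous_on_mult continuous_on_prod; simp)
qed

section \<open>Power series in nilpotent matrices\<close>

definition mpow :: "'a::rch^'n^'n \<Rightarrow> nat \<Rightarrow> 'a^'n^'n"
  where "mpow X n = ((**) X ^^ n) (mat 1)"

lemma mpow_0 [simp]: "mpow X 0 = mat 1"
  by (simp add: mpow_def)

lemma mpow_Suc [simp]: "mpow X (Suc n) = X ** mpow X n"
  by (simp add: mpow_def)

lemma mpow_add: "mpow X (m + n) = mpow X m ** mpow X n"
  by (induction m) (simp_all add: matrix_mul_assoc)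

lemma mpow_mult_commute: "mpow X n ** X = X ** mpow X n"
  by (induction n) (simp_all add: matrix_mul_assoc[symmetric])

lemma mpow_adj: "adj (mpow X n) = mpow (adj X) n"
  by (induction n) (simp_all add: mpow_mult_commute)

lemma mpow_scaleR: "mpow (r *\<^sub>R X) n = r ^ n *\<^sub>R mpow X n"
  by (induction n) simp_all

lemma mpow_intertwine:
  assumes "X ** A = A ** Y"
  shows "mpow X n ** A = A ** mpow Y n"
proof (induction n)
  case (Suc n)
  then have "mpow X (Suc n) ** A = (X ** A) ** mpow Y n"
    by (simp flip: matrix_mul_assoc)
  also have "\<dots> = A ** mpow Y (Suc n)"
    unfolding assms by (simp flip: matrix_mul_assoc)
  finally show ?case .
qed simp

lemma mpow_eq_0_mono: "mpow X m = 0 \<Longrightarrow> m \<le> n \<Longrightarrow> mpow X n = 0"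
  by (metis le_add_diff_inverse mpow_add times0_left)

text \<open>
  Evaluation of formal power series at a nilpotent matrix is a ring homomorphism that respects
  composition. Identities between formal series, such as \<open>exp (log (1 + x)) = 1 + x\<close>, therefore hold for nilpotent
  matrices over all three algebras, with no discussion of convergence.
\<close>

definition fps_mat :: "real fps \<Rightarrow> 'a::rch^'n^'n \<Rightarrow> 'a^'n^'n"
  where "fps_mat f X = (\<Sum>n. fps_nth f n *\<^sub>R mpow X n)"

lemma mexp_eq_fps_mat: "mexp X = fps_mat (fps_exp 1) X"
  by (simp add: mexp_def fps_mat_def mpow_def)

lemma fps_mat_eq_sum:
  assumes "mpow X m = 0"
  shows "fps_mat f X = (\<Sum>n<m. fps_nth f n *\<^sub>R mpow X n)"
  unfolding fps_mat_def
  by (rule suminf_finite) (use assms mpow_eq_0_mono in \<open>auto simp: not_less\<close>)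

definition nilpotent_mat :: "'a::rch^'n^'n \<Rightarrow> bool"
  where "nilpotent_mat X \<longleftrightarrow> (\<exists>m. mpow X m = 0)"

lemma fps_mat_add:
  assumes "nilpotent_mat X"
  shows "fps_mat (f + g) X = fps_mat f X + fps_mat g X"
  using assms unfolding nilpotent_mat_def
  by (auto simp: fps_mat_eq_sum scaleR_left_distrib sum.distrib)

lemma fps_mat_mult:
  assumes "nilpotent_mat X"
  shows "fps_mat (f * g) X = fps_mat f X ** fps_mat g X"
proof -
  obtain m where m: "mpow X m = 0" using assms by (auto simp: nilpotent_mat_def)
  have ld: "A ** sum F S = (\<Sum>i\<in>S. A ** F i)" for A :: "'a^'b^'b" and F :: "nat \<Rightarrow> 'a^'b^'b" and S
    by (rule linear_sum[OF linear_matrix_mult_left])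
  have rd: "sum F S ** A = (\<Sum>i\<in>S. F i ** A)" for A :: "'a^'b^'b" and F :: "nat \<Rightarrow> 'a^'b^'b" and S
    by (rule linear_sum[OF linear_matrix_mult_right])
  have "fps_mat f X ** fps_mat g X =
      (\<Sum>(i,j)\<in>{..<m} \<times> {..<m}. (fps_nth f i * fps_nth g j) *\<^sub>R mpow X (i + j))"
    by (simp add: fps_mat_eq_sum[OF m] ld rd sum.cartesian_product[symmetric] mpow_add mult.commute
        scaleR_sum_right) (rule sum.swap)
  also have "\<dots> = (\<Sum>(i,j)\<in>{(i,j). i + j < m}. (fps_nth f i * fps_nth g j) *\<^sub>R mpow X (i + j))"
    by (rule sum.mono_neutral_right) (auto, meson mpow_eq_0_mono[OF m] not_less)
  also have "\<dots> = (\<Sum>k<m. \<Sum>i\<le>k. (fps_nth f i * fps_nth g (k - i)) *\<^sub>R mpow X (i + (k - i)))"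
    by (rule sum.triangle_reindex)
  also have "\<dots> = fps_mat (f * g) X"
    by (simp add: fps_mat_eq_sum[OF m] fps_mult_nth scaleR_sum_left atLeast0AtMost)
  finally show ?thesis ..
qed

lemma fps_mat_1 [simp]: "fps_mat 1 X = mat 1"
proof -
  have "fps_mat 1 X = (\<Sum>n<1. fps_nth 1 n *\<^sub>R mpow X n)"
    unfolding fps_mat_def by (rule suminf_finite) auto
  then show ?thesis by simp
qed

lemma fps_mat_X [simp]: "fps_mat fps_X X = X"
proof -
  have "fps_mat fps_X X = (\<Sum>n<2. fps_nth fps_X n *\<^sub>R mpow X n)"
    unfolding fps_mat_def by (rule suminf_finite) (auto simp: fps_X_nth)
  then show ?thesis by (simp add: numeral_2_eq_2)
qed

lemma fps_mat_power:
  assumes "nilpotent_mat X"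
  shows "fps_mat (g ^ k) X = mpow (fps_mat g X) k"
  by (induction k) (simp_all add: fps_mat_mult[OF assms])

lemma mpow_fps_mat_eq_0:
  assumes "mpow X m = 0" "fps_nth g 0 = 0"
  shows "mpow (fps_mat g X) m = 0"
proof -
  have "fps_mat (g ^ m) X = (\<Sum>n<m. fps_nth (g ^ m) n *\<^sub>R mpow X n)"
    by (rule fps_mat_eq_sum[OF assms(1)])
  also have "\<dots> = 0"
    by (rule sum.neutral) (use assms(2) in \<open>auto simp: startsby_zero_power_prefix\<close>)
  finally show ?thesis
    using assms(1) by (subst fps_mat_power[symmetric]) (auto simp: nilpotent_mat_def)
qed

text \<open>
  The constant term of \<open>g\<close> vanishes, so \<open>g ^ i\<close> starts in degree \<open>i\<close> and both sides are the same finite double sum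
  below the order of nilpotency.
\<close>

lemma fps_mat_compose:
  assumes X: "nilpotent_mat X" and g: "fps_nth g 0 = 0"
  shows "fps_mat (f oo g) X = fps_mat f (fps_mat g X)"
proof -
  obtain m where m: "mpow X m = 0" using X by (auto simp: nilpotent_mat_def)
  have "fps_mat (f oo g) X = (\<Sum>n<m. \<Sum>i<m. (fps_nth f i * fps_nth (g ^ i) n) *\<^sub>R mpow X n)"
    unfolding fps_mat_eq_sum[OF m]
  proof (rule sum.cong)
    fix n assume "n \<in> {..<m}"
    then have "fps_nth (f oo g) n = (\<Sum>i<m. fps_nth f i * fps_nth (g ^ i) n)"
      unfolding fps_compose_nth
      by (intro sum.mono_neutral_left) (auto simp: startsby_zero_power_prefix[OF g])
    then show "fps_nth (f oo g) n *\<^sub>R mpow X n = (\<Sum>i<m. (fps_nth f i * fps_nth (g ^ i) n) *\<^sub>R mpow X n)"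
      by (simp add: scaleR_sum_left)
  qed simp
  also have "\<dots> = (\<Sum>i<m. fps_nth f i *\<^sub>R fps_mat (g ^ i) X)"
    unfolding fps_mat_eq_sum[OF m] by (subst sum.swap) (simp add: scaleR_sum_right)
  also have "\<dots> = fps_mat f (fps_mat g X)"
    by (simp add: fps_mat_power[OF X] fps_mat_eq_sum[OF mpow_fps_mat_eq_0[OF m g]])
  finally show ?thesis .
qed

lemma nilpotent_fps_mat:
  "nilpotent_mat X \<Longrightarrow> fps_nth g 0 = 0 \<Longrightarrow> nilpotent_mat (fps_mat g X)"
  unfolding nilpotent_mat_def using mpow_fps_mat_eq_0 by blast

lemma fps_mat_scaleR: "fps_mat f (r *\<^sub>R X) = fps_mat (Abs_fps (\<lambda>n. fps_nth f n * r ^ n)) X"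
  by (simp add: fps_mat_def mpow_scaleR)

lemma mexp_scaleR: "mexp (r *\<^sub>R X) = fps_mat (fps_exp r) X"
  by (simp add: mexp_eq_fps_mat fps_mat_scaleR fps_exp_def)

lemma mexp_minus_mult:
  assumes "nilpotent_mat X"
  shows "mexp (- X) ** mexp X = mat 1"
proof -
  have "mexp (- X) ** mexp X = fps_mat (fps_exp (-1) * fps_exp 1) X"
    using mexp_scaleR[of "-1" X] mexp_scaleR[of 1 X] by (simp add: fps_mat_mult[OF assms])
  also have "fps_exp (-1) * fps_exp 1 = (1 :: real fps)"
    by (simp flip: fps_exp_add_mult)
  finally show ?thesis by simp
qed

text \<open>
  The series of \<open>log (1 + x)\<close>, given as the compositional inverse of \<open>exp x - 1\<close>, which at once makes
  logarithm and exponential inverse to each other on nilpotent matrices.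
\<close>

definition fps_log1p :: "real fps"
  where "fps_log1p = fps_inv (fps_exp 1 - 1)"

lemma fps_log1p_0: "fps_nth fps_log1p 0 = 0"
  by (simp add: fps_log1p_def fps_inv_def)

lemma fps_exp_minus_1_nth: "fps_nth (fps_exp 1 - 1) 0 = (0::real)" "fps_nth (fps_exp 1 - 1) 1 \<noteq> (0::real)"
  by simp_all

lemma mexp_fps_log1p:
  assumes "nilpotent_mat N"
  shows "mexp (fps_mat fps_log1p N) = mat 1 + N"
proof -
  have "(fps_exp 1 - 1) oo fps_log1p = fps_X"
    unfolding fps_log1p_def by (rule fps_inv_right[OF fps_exp_minus_1_nth])
  then have "fps_exp 1 oo fps_log1p = 1 + fps_X"
    by (simp add: fps_compose_sub_distrib algebra_simps)
  then show ?thesis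
    by (simp add: mexp_eq_fps_mat fps_mat_compose[OF assms fps_log1p_0, symmetric] fps_mat_add[OF assms])
qed

lemma fps_log1p_mexp:
  assumes "nilpotent_mat X"
  shows "fps_mat fps_log1p (mexp X - mat 1) = X"
proof -
  have "fps_mat (fps_exp 1 - 1) X + fps_mat 1 X = fps_mat (fps_exp 1 - 1 + 1) X"
    by (rule fps_mat_add[OF assms, symmetric])
  then have "mexp X - mat 1 = fps_mat (fps_exp 1 - 1) X"
    by (simp add: mexp_eq_fps_mat algebra_simps)
  then have "fps_mat fps_log1p (mexp X - mat 1) = fps_mat (fps_log1p oo (fps_exp 1 - 1)) X"
    by (simp add: fps_mat_compose[OF assms])
  also have "fps_log1p oo (fps_exp 1 - 1) = fps_X"
    unfolding fps_log1p_def by (rule fps_inv[OF fps_exp_minus_1_nth])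
  finally show ?thesis by simp
qed

text \<open>
  The logarithm is a left inverse of the exponential on nilpotent matrices.
\<close>

lemma mexp_inj_nilpotent:
  assumes "nilpotent_mat X" "nilpotent_mat Y" "mexp X = mexp Y"
  shows "X = Y"
  using assms fps_log1p_mexp by metis

lemma fps_mat_adj:
  assumes "nilpotent_mat X"
  shows "adj (fps_mat f X) = fps_mat f (adj X)"
proof -
  obtain m where m: "mpow X m = 0" using assms by (auto simp: nilpotent_mat_def)
  then have m': "mpow (adj X) m = 0" by (simp flip: mpow_adj)
  show ?thesis
    by (simp add: fps_mat_eq_sum[OF m] fps_mat_eq_sum[OF m'] linear_sum[OF linear_adj] mpow_adj)
qed

lemma nilpotent_adj: "nilpotent_mat X \<Longrightarrow> nilpotent_mat (adj X)"
  unfolding nilpotent_mat_def by (metis mpow_adj adj_0)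

lemma fps_mat_intertwine:
  assumes "nilpotent_mat X" "nilpotent_mat Y" "X ** A = A ** Y"
  shows "fps_mat f X ** A = A ** fps_mat f Y"
proof -
  obtain k l where "mpow X k = 0" "mpow Y l = 0" using assms by (auto simp: nilpotent_mat_def)
  then have m: "mpow X (max k l) = 0" "mpow Y (max k l) = 0"
    using mpow_eq_0_mono by (metis max.cobounded1, metis max.cobounded2)
  show ?thesis
    by (simp add: fps_mat_eq_sum[OF m(1)] fps_mat_eq_sum[OF m(2)] linear_sum[OF linear_matrix_mult_left]
        linear_sum[OF linear_matrix_mult_right] mpow_intertwine[OF assms(3)])
qed

lemma continuous_on_mexp_nilpotent:
  assumes "nilpotent_mat X"
  shows "continuous_on S (\<lambda>s. mexp (s *\<^sub>R X))"
proof -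
  obtain m where m: "mpow X m = 0" using assms by (auto simp: nilpotent_mat_def)
  have "(\<lambda>s. mexp (s *\<^sub>R X)) = (\<lambda>s. \<Sum>n<m. (s ^ n / fact n) *\<^sub>R mpow X n)"
    by (simp add: mexp_scaleR fps_mat_eq_sum[OF m] fun_eq_iff)
  then show ?thesis
    by (simp only:) (intro continuous_intros; simp)
qed

lemma raises_0 [simp]: "raises lv 0"
  by (simp add: raises_def)

lemma raises_add: "raises lv X \<Longrightarrow> raises lv Y \<Longrightarrow> raises lv (X + Y :: 'b::monoid_add^'n^'n)"
  unfolding raises_def by (metis add.right_neutral vector_add_component)

lemma raises_scaleR: "raises lv X \<Longrightarrow> raises lv (r *\<^sub>R X)"
  unfolding raises_def by auto

lemma raises_sum: "(\<And>i. i \<in> S \<Longrightarrow> raises lv (F i)) \<Longrightarrow> raises lv (sum F S)"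
  by (induction S rule: infinite_finite_induct) (auto simp: raises_add)

lemma raises_mult:
  fixes X Y :: "'b::semiring_1^'n^'n"
  assumes "raises lv X" "raises lv Y"
  shows "raises lv (X ** Y)"
  unfolding raises_def
proof (intro allI impI)
  fix i j assume "(X ** Y) $ i $ j \<noteq> 0"
  then obtain k where "X $ i $ k * Y $ k $ j \<noteq> 0"
    unfolding matrix_matrix_mult_def by (auto elim: sum.not_neutral_contains_not_neutral)
  then have "X $ i $ k \<noteq> 0" "Y $ k $ j \<noteq> 0" by auto
  then show "lv j < lv i"
    using assms unfolding raises_def by (meson less_trans)
qed

lemma raises_mpow:
  assumes "raises lv X" "mpow X n $ i $ j \<noteq> 0"
  shows "lv j + int n \<le> lv i"
  using assms(2)
proof (induction n arbitrary: i)
  case 0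
  then show ?case by (auto simp: mat_def split: if_splits)
next
  case (Suc n)
  then obtain k where "X $ i $ k * mpow X n $ k $ j \<noteq> 0"
    unfolding mpow_Suc matrix_matrix_mult_def by (auto elim: sum.not_neutral_contains_not_neutral)
  then have "X $ i $ k \<noteq> 0" "mpow X n $ k $ j \<noteq> 0" by auto
  then have "lv k < lv i" "lv j + int n \<le> lv k"
    using assms(1) Suc.IH by (auto simp: raises_def)
  then show ?case by simp
qed

text \<open>
  The \<open>n\<close>-th power raises degrees by at least \<open>n\<close>, which is impossible once \<open>n\<close> exceeds the spread of the
  finitely many degrees.
\<close>

lemma raises_imp_nilpotent:
  fixes X :: "'a::rch^'n^'n"
  assumes "raises lv X"
  shows "nilpotent_mat X"
proof -
  define m where "m = nat (Max (range lv) - Min (range lv) + 1)"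
  have "mpow X m $ i $ j = 0" for i j
  proof (rule ccontr)
    assume "mpow X m $ i $ j \<noteq> 0"
    then have "lv j + int m \<le> lv i" by (rule raises_mpow[OF assms])
    moreover have "lv i \<le> Max (range lv)" "Min (range lv) \<le> lv j" by auto
    ultimately show False unfolding m_def by linarith
  qed
  then have "mpow X m = 0" by (simp add: vec_eq_iff)
  then show ?thesis by (auto simp: nilpotent_mat_def)
qed

lemma raises_mpow_Suc: "raises lv X \<Longrightarrow> raises lv (mpow X (Suc n))"
  by (induction n) (auto intro: raises_mult)

lemma raises_fps_mat:
  assumes "raises lv X" "fps_nth f 0 = 0"
  shows "raises lv (fps_mat f X)"
proof -
  obtain m where m: "mpow X m = 0"
    using raises_imp_nilpotent[OF assms(1)] by (auto simp: nilpotent_mat_def)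
  have "raises lv (fps_nth f n *\<^sub>R mpow X n)" for n
    using assms raises_mpow_Suc by (cases n) (auto intro!: raises_scaleR simp del: mpow_Suc)
  then show ?thesis
    by (simp add: fps_mat_eq_sum[OF m] raises_sum)
qed

lemma raises_mexp:
  assumes "raises lv X"
  shows "raises lv (mexp X - mat 1)"
proof -
  have "mexp X - mat 1 = fps_mat (fps_exp 1 - 1) X"
    using fps_mat_add[OF raises_imp_nilpotent[OF assms], of "fps_exp 1 - 1" 1]
    by (simp add: mexp_eq_fps_mat)
  then show ?thesis by (simp add: raises_fps_mat[OF assms])
qed

lemma mpow_diag: "mpow (diag s) n = diag (\<chi> i. s $ i ^ n)"
  by (induction n) (simp_all add: diag_1 diag_mult_diag)

lemma linear_diag: "linear diag"
  by (simp add: linear_iff diag_def vec_eq_iff) (simp add: of_real_def)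

lemma sums_mexp_diag:
  "(\<lambda>n. (1 / fact n) *\<^sub>R mpow (diag s) n) sums (diag (\<chi> i. exp (s $ i)) :: 'a::rch^'n^'n)"
proof -
  have "(\<lambda>n. (\<chi> i. (1 / fact n) * s $ i ^ n)) sums (\<chi> i. exp (s $ i))"
    unfolding sums_def
  proof (rule vec_tendstoI)
    fix i
    show "(\<lambda>n. (\<Sum>k<n. \<chi> i. (1 / fact k) * s $ i ^ k) $ i) \<longlonglongrightarrow> (\<chi> i. exp (s $ i)) $ i"
      using exp_converges[of "s $ i"] by (simp add: sums_def divide_inverse)
  qed
  then have "(\<lambda>n. diag (\<chi> i. (1 / fact n) * s $ i ^ n) :: 'a^'n^'n) sums diag (\<chi> i. exp (s $ i))"
    by (rule bounded_linear.sums[OF linear_conv_bounded_linear[THEN iffD1, OF linear_diag]])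
  moreover have "(diag (\<chi> i. (1 / fact n) * s $ i ^ n) :: 'a^'n^'n) = (1 / fact n) *\<^sub>R mpow (diag s) n" for n
    unfolding mpow_diag by (auto simp: vec_eq_iff diag_def of_real_def)
  ultimately show ?thesis by simp
qed

text \<open>
  Matrices of this form are nilpotent only for \<open>s = 0\<close>, so the exponential is a genuine limit here, taken entrywise.
\<close>

lemma mexp_conj_diag:
  fixes A B :: "'a::rch^'n^'n"
  assumes "B ** A = mat 1"
  shows "mexp (A ** diag s ** B) = A ** diag (\<chi> i. exp (s $ i)) ** B"
proof -
  have AB: "A ** B = mat 1" using assms by (rule matrix_left_inverse_imp_right)
  have "mpow (A ** diag s ** B) n ** A = A ** mpow (diag s) n" for n
    by (rule mpow_intertwine) (simp add: assms flip: matrix_mul_assoc)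
  then have p: "mpow (A ** diag s ** B) n = A ** mpow (diag s) n ** B" for n
    by (metis AB matrix_mul_assoc matrix_mul_rid)
  have "linear (\<lambda>X. A ** X ** B)"
    by (simp add: linear_iff matrix_add_ldistrib matrix_add_rdistrib)
  then have "(\<lambda>n. A ** ((1 / fact n) *\<^sub>R mpow (diag s) n) ** B) sums (A ** diag (\<chi> i. exp (s $ i)) ** B)"
    by (intro bounded_linear.sums[OF _ sums_mexp_diag]) (simp add: linear_conv_bounded_linear)
  then show ?thesis
    unfolding mexp_def mpow_def[symmetric] p by (simp add: sums_iff)
qed

section \<open>Weight coordinates\<close>

text \<open>
  An opaque name: the simplifier would rewrite \<open>sqrt (1 / 2)\<close> before its square can be used.
\<close>

definition root_half :: real
  where "root_half = sqrt (1 / 2)"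

lemma root_half_mult [simp]:
  "root_half * root_half = 1 / 2" "root_half * (root_half * x) = x / 2" "root_half * (2 * root_half) = 1"
proof -
  show a: "root_half * root_half = 1 / 2"
    by (simp add: root_half_def)
  show "root_half * (root_half * x) = x / 2" "root_half * (2 * root_half) = 1"
    using a by (simp_all flip: mult.assoc)
qed

text \<open>
  The columns are the common eigenvectors of \<open>\<aa>\<close>: in \<open>(q, q, p - q)\<close>-block form, \<open>(e, e, 0)\<close> and \<open>(e, -e, 0)\<close>, both normalized to
  length 1, and \<open>(0, 0, e)\<close>. The matrix is real, symmetric and orthogonal, hence its own inverse, and conjugation by it
  commutes with \<open>adj\<close>.
\<close>

definition cayley :: "('a::rch, 'q::finite, 'r::finite) gmat"
  where "cayley = (\<chi> i j. case (i, j) of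
      (Inl k, Inl l) \<Rightarrow> if k = l then of_real (root_half) else 0
    | (Inl k, Inr (Inl l)) \<Rightarrow> if k = l then of_real (root_half) else 0
    | (Inr (Inl k), Inl l) \<Rightarrow> if k = l then of_real (root_half) else 0
    | (Inr (Inl k), Inr (Inl l)) \<Rightarrow> if k = l then - of_real (root_half) else 0
    | (Inr (Inr k), Inr (Inr l)) \<Rightarrow> if k = l then 1 else 0
    | _ \<Rightarrow> 0)"

lemma cayley_mult_nth [simp]:
  fixes A :: "'a::rch^'n^('q::finite + ('q + 'r::finite))"
  shows
  "(cayley ** A) $ Inl k $ j = root_half *\<^sub>R (A $ Inl k $ j + A $ Inr (Inl k) $ j)"
  "(cayley ** A) $ Inr (Inl k) $ j = root_half *\<^sub>R (A $ Inl k $ j - A $ Inr (Inl k) $ j)"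
  "(cayley ** A) $ Inr (Inr l) $ j = A $ Inr (Inr l) $ j"
  by (simp_all add: cayley_def matrix_matrix_mult_def sum_UNIV_sum if_distrib if_distribR
      of_real_def scaleR_add_right scaleR_diff_right cong: if_cong)

lemma mult_cayley_nth [simp]:
  fixes A :: "'a::rch^('q::finite + ('q + 'r::finite))^'n"
  shows
  "(A ** cayley) $ i $ Inl k = root_half *\<^sub>R (A $ i $ Inl k + A $ i $ Inr (Inl k))"
  "(A ** cayley) $ i $ Inr (Inl k) = root_half *\<^sub>R (A $ i $ Inl k - A $ i $ Inr (Inl k))"
  "(A ** cayley) $ i $ Inr (Inr l) = A $ i $ Inr (Inr l)"
  by (simp_all add: cayley_def matrix_matrix_mult_def sum_UNIV_sum if_distrib if_distribR
      of_real_def scaleR_add_right scaleR_diff_right cong: if_cong)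

lemma cayley_nth:
  "cayley $ Inl k $ Inl l = (if k = l then of_real (root_half) else 0)"
  "cayley $ Inl k $ Inr (Inl l) = (if k = l then of_real (root_half) else 0)"
  "cayley $ Inr (Inl k) $ Inl l = (if k = l then of_real (root_half) else 0)"
  "cayley $ Inr (Inl k) $ Inr (Inl l) = (if k = l then - of_real (root_half) else 0)"
  "cayley $ Inl k $ Inr (Inr m) = 0" "cayley $ Inr (Inl k) $ Inr (Inr m) = 0"
  "cayley $ Inr (Inr m) $ Inl k = 0" "cayley $ Inr (Inr m) $ Inr (Inl k) = 0"
  "cayley $ Inr (Inr m) $ Inr (Inr n) = (if m = n then 1 else 0)"
  by (simp_all add: cayley_def)

lemma cayley_mult_self: "cayley ** cayley = mat 1"
  by (auto simp: vec_eq_iff all_sum_type cayley_nth mat_def of_real_def simp flip: scaleR_left_distrib)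

lemma mult_cayley_cayley [simp]:
  fixes A :: "'a::rch^('q::finite + ('q + 'r::finite))^'n"
  shows "A ** cayley ** cayley = A"
  by (simp add: cayley_mult_self flip: matrix_mul_assoc)

lemma adj_cayley [simp]: "adj cayley = cayley"
  by (auto simp: vec_eq_iff all_sum_type cayley_nth)

text \<open>
  The matrix of \<open>X\<close> in the basis of weight vectors.
\<close>

definition wmat :: "('a::rch, 'q::finite, 'r::finite) gmat \<Rightarrow> ('a, 'q, 'r) gmat"
  where "wmat X = cayley ** X ** cayley"

lemma wmat_wmat [simp]: "wmat (wmat X) = X"
  by (simp add: wmat_def matrix_mul_assoc cayley_mult_self)

lemma wmat_mult: "wmat (X ** Y) = wmat X ** wmat Y"
  by (simp add: wmat_def matrix_mul_assoc)

lemma wmat_1 [simp]: "wmat (mat 1) = mat 1"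
  by (simp add: wmat_def cayley_mult_self)

lemma linear_wmat: "linear wmat"
  by (simp add: wmat_def linear_iff matrix_add_ldistrib matrix_add_rdistrib)

lemmas wmat_add = linear_add[OF linear_wmat]
lemmas wmat_diff = linear_diff[OF linear_wmat]
lemmas wmat_minus = linear_neg[OF linear_wmat]
lemmas wmat_scaleR = linear_cmul[OF linear_wmat]
lemmas wmat_0 = linear_0[OF linear_wmat]
lemmas wmat_sum = linear_sum[OF linear_wmat]

lemma adj_wmat: "adj (wmat X) = wmat (adj X)"
  by (simp add: wmat_def matrix_mul_assoc)

lemma cdet_wmat:
  fixes X :: "('a::rch, 'q::finite, 'r::finite) gmat"
  shows "cdet UNIV (wmat X) = cdet UNIV X"
proof -
  have "cdet UNIV (cayley :: ('a, 'q, 'r) gmat) * cdet UNIV (cayley :: ('a, 'q, 'r) gmat) = 1"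
    by (simp flip: cdet_mult add: cayley_mult_self)
  then show ?thesis
    by (simp add: wmat_def cdet_mult mult.commute)
qed

lemma mpow_wmat: "mpow (wmat X) n = wmat (mpow X n)"
  by (induction n) (simp_all add: wmat_mult)

lemma nilpotent_wmat: "nilpotent_mat (wmat X) \<longleftrightarrow> nilpotent_mat X"
  unfolding nilpotent_mat_def mpow_wmat by (metis wmat_wmat wmat_0)

lemma wmat_fps_mat:
  assumes "nilpotent_mat X"
  shows "wmat (fps_mat f X) = fps_mat f (wmat X)"
proof -
  obtain m where m: "mpow X m = 0" using assms by (auto simp: nilpotent_mat_def)
  then have m': "mpow (wmat X) m = 0" by (simp add: mpow_wmat wmat_0)
  show ?thesis
    by (simp add: fps_mat_eq_sum[OF m] fps_mat_eq_sum[OF m'] mpow_wmat wmat_sum wmat_scaleR)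
qed

text \<open>
  The eigenvalues of \<open>H_mat t\<close> on the columns of \<open>cayley\<close>.
\<close>

definition weight :: "real^'q \<Rightarrow> real^('q::finite + ('q + 'r::finite))"
  where "weight t = (\<chi> i. case i of Inl k \<Rightarrow> t $ k | Inr (Inl k) \<Rightarrow> - t $ k | Inr (Inr _) \<Rightarrow> 0)"

lemma weight_nth [simp]: "weight t $ Inl k = t $ k" "weight t $ Inr (Inl k) = - t $ k" "weight t $ Inr (Inr l) = 0"
  by (simp_all add: weight_def)

lemma wmat_H_mat: "wmat (H_mat t) = (diag (weight t) :: ('a::rch, 'q::finite, 'r::finite) gmat)"
  by (auto simp: wmat_def vec_eq_iff all_sum_type H_mat_def diag_def of_real_def
      scaleR_right_diff_distrib scaleR_right_distrib
      simp flip: scaleR_left_distrib scaleR_left_diff_distrib scaleR_minus_left)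

lemma H_mat_eq: "H_mat t = cayley ** diag (weight t) ** cayley"
  by (metis wmat_H_mat wmat_wmat wmat_def)

lemma a_mat_eq: "a_mat t = wmat (diag (\<chi> i. exp (weight t $ i)))"
  unfolding a_mat_def H_mat_eq wmat_def by (rule mexp_conj_diag[OF cayley_mult_self])

lemma mexp_H_mat: "mexp (H_mat t) = a_mat t"
  by (simp add: a_mat_def)

lemma wmat_a_mat: "wmat (a_mat t) = diag (\<chi> i. exp (weight t $ i))"
  by (simp add: a_mat_eq)

definition form_signs :: "real^('q::finite + 'p::finite)"
  where "form_signs = (\<chi> i. case i of Inl _ \<Rightarrow> 1 | Inr _ \<Rightarrow> -1)"

lemma form_signs_nth [simp]: "form_signs $ Inl k = 1" "form_signs $ Inr l = -1"
  by (simp_all add: form_signs_def)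

lemma diag_form_signs_mult_self: "diag form_signs ** diag form_signs = (mat 1 :: 'a::rch^('q::finite + 'p::finite)^('q + 'p))"
  by (auto simp: vec_eq_iff all_sum_type diag_mult_diag) (auto simp: diag_def mat_def)

lemma mult_form_signs_form_signs [simp]:
  fixes A :: "'a::rch^('q::finite + 'p::finite)^'n"
  shows "A ** diag form_signs ** diag form_signs = A"
  by (simp add: diag_form_signs_mult_self flip: matrix_mul_assoc)

text \<open>
  In weight coordinates the invariant form pairs the vector of weight \<open>t\<^sub>k\<close> with the one of weight
  \<open>- t\<^sub>k\<close> and is \<open>-1\<close> on the vectors of weight zero; \<open>opposite\<close> is the partner and \<open>dual_sign\<close> the value of the
  pairing. The weight vectors of nonzero weight are thus isotropic.
\<close>

definition opposite :: "'q + ('q + 'r) \<Rightarrow> 'q + ('q + 'r)"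
  where "opposite i = (case i of Inl k \<Rightarrow> Inr (Inl k) | Inr (Inl k) \<Rightarrow> Inl k | Inr (Inr l) \<Rightarrow> Inr (Inr l))"

definition dual_sign :: "'q + ('q + 'r) \<Rightarrow> real"
  where "dual_sign i = (case i of Inr (Inr l) \<Rightarrow> -1 | _ \<Rightarrow> 1)"

lemma opposite_simps [simp]:
  "opposite (Inl k) = Inr (Inl k)" "opposite (Inr (Inl k)) = Inl k" "opposite (Inr (Inr l)) = Inr (Inr l)"
  "dual_sign (Inl k) = 1" "dual_sign (Inr (Inl k)) = 1" "dual_sign (Inr (Inr l)) = -1"
  by (simp_all add: opposite_def dual_sign_def)

lemma weight_opposite [simp]: "weight t $ opposite i = - weight t $ i"
  by (simp add: opposite_def split: sum.split)

lemma wmat_form_signs: "wmat (diag form_signs) = ((\<chi> i j. if j = opposite i then of_real (dual_sign i) else 0) :: ('a::rch, 'q::finite, 'r::finite) gmat)"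
  by (auto simp: wmat_def vec_eq_iff all_sum_type diag_def of_real_def
      scaleR_right_diff_distrib scaleR_right_distrib
      simp flip: scaleR_left_distrib scaleR_left_diff_distrib scaleR_minus_left)

lemma wmat_form_signs_mult_nth: "(wmat (diag form_signs) ** A) $ i $ j = of_real (dual_sign i) * A $ opposite i $ j"
  by (simp add: wmat_form_signs matrix_matrix_mult_def if_distrib if_distribR cong: if_cong)

lemma opposite_opposite [simp]: "opposite (opposite i) = i"
  by (simp add: opposite_def split: sum.split)

lemma dual_sign_opposite [simp]: "dual_sign (opposite i) = dual_sign i"
  by (simp add: opposite_def split: sum.split)

lemma mult_wmat_form_signs_nth: "(A ** wmat (diag form_signs)) $ i $ j = A $ i $ opposite j * of_real (dual_sign j)"
proof -
  have "j = opposite k \<longleftrightarrow> k = opposite j" for k by auto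
  then show ?thesis
    by (simp add: wmat_form_signs matrix_matrix_mult_def if_distrib if_distribR cong: if_cong)
qed

text \<open>
  Isometries of the form, in matrix shape and without a condition on the determinant.
\<close>

definition pseudo_unitary :: "('a::rch^('q::finite + 'p::finite)^('q + 'p)) set"
  where "pseudo_unitary = {g. adj g ** diag form_signs ** g = diag form_signs}"

lemma pseudo_unitary_mult:
  assumes "g \<in> pseudo_unitary" "h \<in> pseudo_unitary"
  shows "g ** h \<in> pseudo_unitary"
proof -
  have "adj (g ** h) ** diag form_signs ** (g ** h) = adj h ** (adj g ** diag form_signs ** g) ** h"
    by (simp add: matrix_mul_assoc)
  then show ?thesis using assms by (simp add: pseudo_unitary_def)
qed

text \<open>
  The adjoint with respect to the form; it inverts isometries.
\<close>

definition form_adj :: "'a::rch^('q::finite + 'p::finite)^('q + 'p) \<Rightarrow> 'a^('q + 'p)^('q + 'p)"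
  where "form_adj g = diag form_signs ** adj g ** diag form_signs"

lemma form_adj_mult:
  assumes "g \<in> pseudo_unitary"
  shows "form_adj g ** g = mat 1"
proof -
  have "form_adj g ** g = diag form_signs ** (adj g ** diag form_signs ** g)"
    by (simp add: form_adj_def matrix_mul_assoc)
  then show ?thesis
    using assms by (simp add: pseudo_unitary_def diag_form_signs_mult_self)
qed

lemma mult_form_adj: "g \<in> pseudo_unitary \<Longrightarrow> g ** form_adj g = mat 1"
  by (rule matrix_left_inverse_imp_right[OF form_adj_mult])

lemma form_adj_pseudo_unitary:
  assumes "g \<in> pseudo_unitary"
  shows "form_adj g \<in> pseudo_unitary"
proof -
  have "adj (form_adj g) ** diag form_signs ** form_adj g = diag form_signs ** g ** form_adj g"
    by (simp add: form_adj_def matrix_mul_assoc)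
  also have "\<dots> = diag form_signs"
    by (simp add: mult_form_adj[OF assms] flip: matrix_mul_assoc)
  finally show ?thesis by (simp add: pseudo_unitary_def)
qed

lemma form_eq_inner: "form x = inner x (diag form_signs *v x)"
proof -
  have "(diag form_signs *v x) $ i = form_signs $ i *\<^sub>R x $ i" for i
    by (simp add: diag_def matrix_vector_mult_def if_distrib if_distribR of_real_def cong: if_cong)
  then show ?thesis
    by (simp add: form_def inner_vec_def sum_UNIV_sum power2_norm_eq_inner sum_negf)
qed

lemma form_pseudo_unitary: "g \<in> pseudo_unitary \<Longrightarrow> form (g *v x) = form x"
  by (simp add: form_eq_inner inner_matrix_vector_adj matrix_vector_mul_assoc matrix_mul_assoc pseudo_unitary_def)

lemma block_diag_mult: "block_diag u v ** block_diag u' v' = block_diag (u ** u') (v ** v')"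
  by (simp add: vec_eq_iff all_sum_type block_diag_def matrix_matrix_mult_def sum_UNIV_sum)

lemma adj_block_diag: "adj (block_diag u v) = block_diag (adj u) (adj v)"
  by (simp add: vec_eq_iff all_sum_type block_diag_def)

lemma diag_form_signs_eq: "diag form_signs = block_diag (mat 1) (- mat 1)"
  by (auto simp: vec_eq_iff all_sum_type block_diag_def diag_def mat_def)

lemma block_diag_pseudo_unitary_iff:
  "block_diag u v \<in> pseudo_unitary \<longleftrightarrow> u \<in> unitary \<and> v \<in> unitary"
proof -
  have "block_diag a b = block_diag c d \<longleftrightarrow> a = c \<and> b = d"
    for a c :: "'a^'b^'b" and b d :: "'a^'c^'c"
    by (auto simp: vec_eq_iff all_sum_type block_diag_def)
  then show ?thesis
    by (simp add: pseudo_unitary_def unitary_def diag_form_signs_eq adj_block_diag block_diag_mult)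
qed

lemma a_mat_pseudo_unitary: "a_mat t \<in> (pseudo_unitary :: ('a::rch, 'q::finite, 'r::finite) gmat set)"
proof -
  let ?D = "diag (\<chi> i. exp (weight t $ i)) :: ('a, 'q, 'r) gmat"
  have "(?D ** wmat (diag form_signs) ** ?D) $ i $ j = wmat (diag form_signs) $ i $ j" for i j
    by (simp add: wmat_form_signs mult.commute[of _ "dual_sign i"] mult.assoc exp_minus flip: of_real_mult of_real_inverse)
  then have "?D ** wmat (diag form_signs) ** ?D = wmat (diag form_signs)" by (simp add: vec_eq_iff)
  then have "wmat (adj (a_mat t) ** diag form_signs ** a_mat t) = (wmat (diag form_signs) :: ('a, 'q, 'r) gmat)"
    by (simp add: wmat_mult wmat_a_mat adj_wmat[symmetric])
  then show ?thesis
    unfolding pseudo_unitary_def by (metis (mono_tags, lifting) mem_Collect_eq wmat_wmat)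
qed

lemma a_mat_mult_nth:
  fixes A :: "'a::rch^'n^('q::finite + ('q + 'r::finite))"
  shows "(a_mat t ** A) $ Inl k $ j = cosh (t $ k) *\<^sub>R A $ Inl k $ j + sinh (t $ k) *\<^sub>R A $ Inr (Inl k) $ j"
    and "(a_mat t ** A) $ Inr (Inr l) $ j = A $ Inr (Inr l) $ j"
  by (simp_all add: a_mat_eq wmat_def matrix_mul_assoc[symmetric])
     (simp add: of_real_def cosh_def sinh_def algebra_simps flip: scaleR_left_distrib)

lemma cdet_a_mat: "cdet UNIV (a_mat t :: ('a::rch, 'q::finite, 'r::finite) gmat) = 1"
proof -
  have "(\<Prod>i\<in>UNIV. exp ((weight t :: real^('q + ('q + 'r))) $ i)) = 1"
    by (simp flip: exp_sum add: sum_UNIV_sum sum_negf)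
  then have "cdet UNIV (wmat (a_mat t) :: ('a, 'q, 'r) gmat) = 1"
    by (simp add: wmat_a_mat cdet_diag)
  then show ?thesis by (simp add: cdet_wmat)
qed

text \<open>
  The weight at the point whose coordinates are the heights. This point lies in the positive Weyl
  chamber, so the level orders the weight vectors compatibly with all positive roots at once.
\<close>

definition level :: "'q::{finite,linorder} + ('q + 'r) \<Rightarrow> int"
  where "level i = (case i of Inl k \<Rightarrow> height k | Inr (Inl k) \<Rightarrow> - height k | Inr (Inr _) \<Rightarrow> 0)"

lemma level_simps [simp]: "level (Inl k) = height k" "level (Inr (Inl k)) = - height k" "level (Inr (Inr l)) = 0"
  by (simp_all add: level_def)

lemma pos_rootsI:
  "(\<lambda>t. t $ i) \<in> pos_roots" "i < j \<Longrightarrow> (\<lambda>t. t $ i - t $ j) \<in> pos_roots"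
  "(\<lambda>t. t $ i + t $ j) \<in> pos_roots"
proof -
  show "(\<lambda>t. t $ i + t $ j) \<in> pos_roots"
    unfolding pos_roots_def
    by (cases i j rule: linorder_cases) (auto simp: add.commute[of "_ $ i" "_ $ j"])
qed (auto simp: pos_roots_def)

text \<open>
  Every positive root is positive at the point with coordinates \<open>height k\<close>, which gives one
  direction. Conversely, all differences of weights that are positive there are among the positive roots.
\<close>

lemma level_less_iff_pos_root:
  fixes i j :: "'q::{finite,linorder} + ('q + 'r::finite)"
  shows "level j < level i \<longleftrightarrow> (\<lambda>t. weight t $ i - weight t $ j) \<in> pos_roots"
proof
  let ?t = "\<chi> k :: 'q. real_of_int (height k)"
  assume "(\<lambda>t. weight t $ i - weight t $ j) \<in> pos_roots"
  moreover have "0 < \<alpha> ?t" if "\<alpha> \<in> pos_roots" for \<alpha>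
    using that unfolding pos_roots_def by (auto simp: height_pos add_pos_pos)
  ultimately have "0 < weight ?t $ i - weight ?t $ j" by blast
  moreover have "weight ?t $ i = real_of_int (level i)" for i :: "'q + ('q + 'r)"
    by (simp add: weight_def level_def split: sum.split)
  ultimately show "level j < level i" by simp
next
  have "\<forall>i j :: 'q + ('q + 'r). level j < level i \<longrightarrow> (\<lambda>t. weight t $ i - weight t $ j) \<in> pos_roots"
  proof -
    have "\<not> height i < 0" "\<not> height i < - height j" for i j :: 'q
      using height_pos[of i] height_pos[of j] by linarith+
    then show ?thesis
      by (auto simp add: all_sum_type pos_rootsI)
  qed
  then show "level j < level i \<Longrightarrow> (\<lambda>t. weight t $ i - weight t $ j) \<in> pos_roots"
    by blast
qed

section \<open>The nilpotent group of the positive roots\<close>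

text \<open>
  In weight coordinates the bracket with \<open>H_mat t\<close> multiplies the entry at \<open>(i, j)\<close> by the difference
  of the weights of \<open>i\<close> and \<open>j\<close>, so a vector of the root space of \<open>\<alpha>\<close> has entries only
  where that difference is \<open>\<alpha>\<close>.
\<close>

lemma root_space_raises:
  fixes X :: "('a::rch, 'q::{finite,linorder}, 'r::finite) gmat"
  assumes "\<alpha> \<in> pos_roots" "X \<in> root_space \<alpha>"
  shows "raises level (wmat X)"
  unfolding raises_def
proof (intro allI impI)
  fix i j assume nz: "wmat X $ i $ j \<noteq> 0"
  have "weight t $ i - weight t $ j = \<alpha> t" for t
  proof -
    have "H_mat t ** X - X ** H_mat t = \<alpha> t *\<^sub>R X"
      using assms(2) by (simp add: root_space_def)
    then have "wmat (H_mat t ** X - X ** H_mat t) = wmat (\<alpha> t *\<^sub>R X)" by simp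
    then have "diag (weight t) ** wmat X - wmat X ** diag (weight t) = \<alpha> t *\<^sub>R wmat X"
      by (simp add: wmat_diff wmat_mult wmat_scaleR wmat_H_mat)
    then have "(diag (weight t) ** wmat X - wmat X ** diag (weight t)) $ i $ j = (\<alpha> t *\<^sub>R wmat X) $ i $ j"
      by simp
    then have "(weight t $ i - weight t $ j) *\<^sub>R wmat X $ i $ j = \<alpha> t *\<^sub>R wmat X $ i $ j"
      by (simp add: of_real_def scaleR_left_diff_distrib)
    then show ?thesis using nz by simp
  qed
  then have "\<alpha> = (\<lambda>t. weight t $ i - weight t $ j)" by auto
  then show "level j < level i"
    using assms(1) level_less_iff_pos_root by blast
qed

lemma nilp_n_raises:
  assumes "X \<in> nilp_n"
  shows "raises level (wmat X)"
  using assms unfolding nilp_n_def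
proof (induction rule: span_induct)
  show "subspace {X. raises level (wmat X)}"
    by (simp add: subspace_def wmat_0 wmat_add wmat_scaleR raises_add raises_scaleR)
qed (auto intro: root_space_raises)

lemma wmat_mexp:
  assumes "raises lv (wmat X)"
  shows "wmat (mexp X) = mexp (wmat X)"
  using raises_imp_nilpotent[OF assms] by (simp add: mexp_eq_fps_mat wmat_fps_mat nilpotent_wmat)

lemma grp_N_unipotent:
  assumes "n \<in> grp_N"
  shows "raises level (wmat n - mat 1)"
proof -
  obtain X where "X \<in> nilp_n" "n = mexp X" using assms by (auto simp: grp_N_def)
  then show ?thesis
    using nilp_n_raises by (metis raises_mexp wmat_mexp)
qed

text \<open>
  The linearized isometry condition: in contrast to membership in \<open>lie_algebra grp_G\<close> it evidently passes to root
  components.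
\<close>

definition form_skew :: "'a::rch^('q::finite + 'p::finite)^('q + 'p) \<Rightarrow> bool"
  where "form_skew X \<longleftrightarrow> adj X ** diag form_signs = - (diag form_signs ** X)"

lemma nilpotent_minus: "nilpotent_mat X \<Longrightarrow> nilpotent_mat (- X)"
  unfolding nilpotent_mat_def using mpow_scaleR[of "-1" X] by auto

lemma mexp_form_skew:
  assumes "nilpotent_mat X" "form_skew X"
  shows "mexp X \<in> pseudo_unitary"
proof -
  have "adj (mexp X) ** diag form_signs = mexp (adj X) ** diag form_signs"
    by (simp add: mexp_eq_fps_mat fps_mat_adj[OF assms(1)])
  also have "\<dots> = diag form_signs ** mexp (- X)"
    unfolding mexp_eq_fps_mat
    by (rule fps_mat_intertwine)
       (use assms in \<open>simp_all add: nilpotent_adj nilpotent_minus form_skew_def\<close>)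
  finally have "adj (mexp X) ** diag form_signs ** mexp X = diag form_signs ** (mexp (- X) ** mexp X)"
    by (simp add: matrix_mul_assoc)
  then show ?thesis
    by (simp add: pseudo_unitary_def mexp_minus_mult[OF assms(1)])
qed

lemma form_skew_scaleR: "form_skew X \<Longrightarrow> form_skew (r *\<^sub>R X)"
  by (simp add: form_skew_def)

text \<open>
  The exponentials \<open>mexp (s *\<^sub>R X)\<close> are isometries because \<open>X\<close> is skew for the form; their determinant
  is 1 because they are unipotent; and they form a continuous path through the identity, hence stay in its component.
\<close>

lemma raising_skew_in_lie_algebra:
  fixes X :: "('a::rch, 'q::{finite,linorder}, 'r::finite) gmat"
  assumes X: "raises level (wmat X)" and skew: "form_skew X"
  shows "X \<in> lie_algebra grp_G"
proof -
  have nil: "nilpotent_mat X"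
    using raises_imp_nilpotent[OF X] by (simp add: nilpotent_wmat)
  have iso: "mexp (s *\<^sub>R X) \<in> isometries" for s
  proof -
    have r: "raises level (wmat (s *\<^sub>R X))"
      using X by (simp add: wmat_scaleR raises_scaleR)
    have "mexp (s *\<^sub>R X) \<in> pseudo_unitary"
      using raises_imp_nilpotent[OF r] skew
      by (simp add: mexp_form_skew form_skew_scaleR nilpotent_wmat)
    moreover have "cdet UNIV (mexp (s *\<^sub>R X)) = 1"
      by (subst cdet_wmat[symmetric]) (metis wmat_mexp[OF r] raises_mexp[OF r] cdet_unipotent)
    ultimately show ?thesis
      by (simp add: isometries_def form_pseudo_unitary minor_eq_cdet)
  qed
  have conn: "connected (range (\<lambda>s. mexp (s *\<^sub>R X)))"
    by (rule connected_continuous_image[OF continuous_on_mexp_nilpotent[OF nil] connected_UNIV])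
  have "mexp (0 *\<^sub>R X) = mat 1"
    by (simp only: mexp_scaleR fps_exp_0 fps_mat_1)
  then have "mexp (s *\<^sub>R X) \<in> grp_G" for s
    unfolding grp_G_def
    using connected_component_maximal[OF _ conn, of "mat 1" isometries] iso
    by (metis (mono_tags, lifting) image_subset_iff rangeI subsetD)
  then show ?thesis by (simp add: lie_algebra_def)
qed

text \<open>
  The component of \<open>X\<close> in the \<open>\<alpha>\<close>-eigenspace of the adjoint action of \<open>\<aa>\<close>.
\<close>

definition root_part :: "(real^'q \<Rightarrow> real) \<Rightarrow> ('a::rch, 'q::finite, 'r::finite) gmat \<Rightarrow> ('a, 'q, 'r) gmat"
  where "root_part \<alpha> X =
    wmat (\<chi> i j. if (\<lambda>t. weight t $ i - weight t $ j) = \<alpha> then wmat X $ i $ j else 0)"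

lemma wmat_root_part_nth:
  "wmat (root_part \<alpha> X) $ i $ j = (if (\<lambda>t. weight t $ i - weight t $ j) = \<alpha> then wmat X $ i $ j else 0)"
  by (simp add: root_part_def)

lemma form_skew_iff_wmat:
  fixes X :: "('a::rch, 'q::finite, 'r::finite) gmat"
  shows "form_skew X \<longleftrightarrow>
    (\<forall>i j. conj (wmat X $ opposite j $ i) * of_real (dual_sign j) = - (of_real (dual_sign i) * wmat X $ opposite i $ j))"
proof -
  have "form_skew X \<longleftrightarrow> wmat (adj X ** diag form_signs) = wmat (- (diag form_signs ** X))"
    unfolding form_skew_def by (metis wmat_wmat)
  also have "\<dots> \<longleftrightarrow> adj (wmat X) ** wmat (diag form_signs) = - (wmat (diag form_signs) ** wmat X)"
    by (simp add: wmat_mult wmat_minus adj_wmat)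
  finally show ?thesis
    by (simp add: vec_eq_iff mult_wmat_form_signs_nth wmat_form_signs_mult_nth)
qed

text \<open>
  The skewness condition relates the entries at \<open>(opposite j, i)\<close> and \<open>(opposite i, j)\<close>, and the two positions have
  the same difference of weights.
\<close>

lemma form_skew_root_part:
  fixes X :: "('a::rch, 'q::finite, 'r::finite) gmat"
  assumes "form_skew X"
  shows "form_skew (root_part \<alpha> X)"
  unfolding form_skew_iff_wmat wmat_root_part_nth
proof (intro allI)
  fix i j :: "'q + ('q + 'r)"
  have "(\<lambda>t. weight t $ opposite j - weight t $ i) = (\<lambda>t. weight t $ opposite i - weight t $ j)"
    by (simp add: fun_eq_iff)
  then show "conj (if (\<lambda>t. weight t $ opposite j - weight t $ i) = \<alpha> then wmat X $ opposite j $ i else 0) * of_real (dual_sign j) =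
      - (of_real (dual_sign i) * (if (\<lambda>t. weight t $ opposite i - weight t $ j) = \<alpha> then wmat X $ opposite i $ j else 0))"
    using assms[unfolded form_skew_iff_wmat] by simp
qed

lemma root_part_in_root_space:
  fixes X :: "('a::rch, 'q::{finite,linorder}, 'r::finite) gmat"
  assumes "raises level (wmat X)" "form_skew X"
  shows "root_part \<alpha> X \<in> root_space \<alpha>"
proof -
  let ?Y = "root_part \<alpha> X"
  have "raises level (wmat ?Y)"
    using assms(1) by (auto simp: raises_def wmat_root_part_nth)
  then have "?Y \<in> lie_algebra grp_G"
    by (rule raising_skew_in_lie_algebra[OF _ form_skew_root_part[OF assms(2)]])
  moreover have "H_mat t ** ?Y - ?Y ** H_mat t = \<alpha> t *\<^sub>R ?Y" for t
  proof -
    have "(diag (weight t) ** wmat ?Y - wmat ?Y ** diag (weight t)) $ i $ j = (\<alpha> t *\<^sub>R wmat ?Y) $ i $ j" for i j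
      by (auto simp: wmat_root_part_nth of_real_def scaleR_left_diff_distrib)
    then have "wmat (H_mat t ** ?Y - ?Y ** H_mat t) = wmat (\<alpha> t *\<^sub>R ?Y)"
      by (simp add: wmat_diff wmat_mult wmat_scaleR wmat_H_mat vec_eq_iff)
    then show ?thesis by (metis wmat_wmat)
  qed
  ultimately show ?thesis by (simp add: root_space_def)
qed

lemma finite_pos_roots: "finite (pos_roots :: (real^('q::{finite,linorder}) \<Rightarrow> real) set)"
proof -
  have "pos_roots \<subseteq> range (\<lambda>i (t :: real^('q::{finite,linorder})). t $ i) \<union> range (\<lambda>i t. 2 * t $ i) \<union>
      range (\<lambda>(i, j) t. t $ i - t $ j) \<union> range (\<lambda>(i, j) t. t $ i + t $ j)"
    unfolding pos_roots_def by auto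
  then show ?thesis
    by (rule finite_subset) simp
qed

lemma raising_skew_in_nilp_n:
  fixes X :: "('a::rch, 'q::{finite,linorder}, 'r::finite) gmat"
  assumes "raises level (wmat X)" "form_skew X"
  shows "X \<in> nilp_n"
proof -
  have "(\<Sum>\<alpha>\<in>pos_roots. wmat (root_part \<alpha> X) $ i $ j) = wmat X $ i $ j" for i j
  proof (cases "wmat X $ i $ j = 0")
    case True
    then show ?thesis by (auto simp: wmat_root_part_nth intro!: sum.neutral)
  next
    case False
    then have "(\<lambda>t. weight t $ i - weight t $ j) \<in> pos_roots"
      using assms(1) level_less_iff_pos_root by (auto simp: raises_def)
    then show ?thesis by (simp add: wmat_root_part_nth finite_pos_roots)
  qed
  then have "wmat (\<Sum>\<alpha>\<in>pos_roots. root_part \<alpha> X) = wmat X"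
    by (simp add: wmat_sum vec_eq_iff)
  then have "X = (\<Sum>\<alpha>\<in>pos_roots. root_part \<alpha> X)"
    by (metis wmat_wmat)
  also have "\<dots> \<in> nilp_n"
    unfolding nilp_n_def
    by (intro span_sum span_base) (use root_part_in_root_space[OF assms] in blast)
  finally show ?thesis .
qed

text \<open>
  The logarithm \<open>X\<close> of \<open>m\<close> raises levels. Its adjoint \<open>Y\<close> with respect to the form and \<open>- X\<close> are nilpotent with the same
  exponential \<open>m\<^sup>-\<^sup>1\<close>, so they are equal and \<open>X\<close> is skew. A skew matrix that raises levels is the sum of its
  root parts for the positive roots.
\<close>

lemma unipotent_inverse_in_grp_N:
  fixes m :: "('a::rch, 'q::{finite,linorder}, 'r::finite) gmat"
  assumes m: "m \<in> pseudo_unitary" and r: "raises level (wmat m - mat 1)"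
  shows "\<exists>n\<in>grp_N. n ** m = mat 1"
proof -
  define X where "X = fps_mat fps_log1p (m - mat 1)"
  have rN: "raises level (wmat (m - mat 1))"
    using r by (simp add: wmat_diff)
  then have nilN: "nilpotent_mat (m - mat 1)"
    using raises_imp_nilpotent nilpotent_wmat by blast
  have exp: "mexp X = m"
    by (simp add: X_def mexp_fps_log1p[OF nilN])
  have nil: "nilpotent_mat X"
    unfolding X_def by (rule nilpotent_fps_mat[OF nilN fps_log1p_0])
  have rX: "raises level (wmat X)"
    unfolding X_def wmat_fps_mat[OF nilN] by (rule raises_fps_mat[OF rN fps_log1p_0])
  have inv: "mexp (- X) = form_adj m"
  proof -
    have "mexp (- X) = mexp (- X) ** m ** form_adj m"
      by (simp add: mult_form_adj[OF m] flip: matrix_mul_assoc)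
    then show ?thesis
      using mexp_minus_mult[OF nil] by (simp add: exp)
  qed
  define Y where "Y = diag form_signs ** adj X ** diag form_signs"
  have YJ: "Y ** diag form_signs = diag form_signs ** adj X"
    by (simp add: Y_def)
  have nilY: "nilpotent_mat Y"
  proof -
    obtain k where "mpow (adj X) k = 0"
      using nilpotent_adj[OF nil] by (auto simp: nilpotent_mat_def)
    then have "mpow Y k ** diag form_signs ** diag form_signs = 0"
      by (simp only: mpow_intertwine[OF YJ] times0_right times0_left)
    then show ?thesis by (auto simp: nilpotent_mat_def)
  qed
  have "mexp Y ** diag form_signs = diag form_signs ** mexp (adj X)"
    unfolding mexp_eq_fps_mat by (rule fps_mat_intertwine[OF nilY nilpotent_adj[OF nil] YJ])
  then have "mexp Y ** diag form_signs ** diag form_signs = diag form_signs ** mexp (adj X) ** diag form_signs"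
    by (simp only:)
  moreover have "mexp (adj X) = adj m"
    using fps_mat_adj[OF nil, of "fps_exp 1"] by (simp add: exp mexp_eq_fps_mat[symmetric])
  ultimately have "mexp Y = mexp (- X)"
    by (simp add: inv form_adj_def)
  then have "Y = - X"
    by (rule mexp_inj_nilpotent[OF nilY nilpotent_minus[OF nil]])
  then have "diag form_signs ** (adj X ** diag form_signs) = diag form_signs ** (- (diag form_signs ** X))"
    by (simp add: Y_def matrix_mul_assoc diag_form_signs_mult_self)
  then have "diag form_signs ** (diag form_signs ** (adj X ** diag form_signs)) = diag form_signs ** (diag form_signs ** (- (diag form_signs ** X)))"
    by (simp only:)
  then have "form_skew X"
    by (simp add: form_skew_def matrix_mul_assoc diag_form_signs_mult_self)
  then have "X \<in> nilp_n"
    by (rule raising_skew_in_nilp_n[OF rX])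
  then have "- X \<in> nilp_n"
    unfolding nilp_n_def by (rule span_neg)
  then have "mexp (- X) \<in> grp_N"
    by (simp add: grp_N_def)
  then show ?thesis
    using mexp_minus_mult[OF nil] exp by blast
qed

section \<open>The Iwasawa projection and the principal minors\<close>

text \<open>
  The matrix whose Gram matrix is \<open>x_mat t k\<close>. Up to the factor \<open>root_half\<close> it is the top block of \<open>a_mat t ** k\<close>
  applied to the weight vectors of the weights \<open>t\<^sub>k\<close>.
\<close>

definition y_mat :: "real^'q \<Rightarrow> ('a::rch, 'q::finite, 'r::finite) gmat \<Rightarrow> 'a^'q^'q"
  where "y_mat t k = diag (\<chi> i. cosh (t $ i)) ** upper_block k
    + diag (\<chi> i. sinh (t $ i)) ** (adj sigma0 ** lower_block k ** sigma0)"

lemma x_mat_eq: "x_mat t k = adj (y_mat t k) ** y_mat t k"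
  by (simp add: x_mat_def y_mat_def Let_def)

lemma mult_sigma0_nth: "((A :: 'a::rch^('q::finite + 'r::finite)^'n) ** sigma0) $ i $ j = A $ i $ Inl j"
  by (simp add: sigma0_def matrix_matrix_mult_def sum_UNIV_sum if_distrib if_distribR cong: if_cong)

lemma adj_sigma0_mult_nth: "(adj sigma0 ** (A :: 'a::rch^'n^('q::finite + 'r::finite))) $ i $ j = A $ Inl i $ j"
  by (simp add: sigma0_def matrix_matrix_mult_def sum_UNIV_sum if_distrib if_distribR cong: if_cong)

lemma y_mat_nth:
  "y_mat t k $ i $ j = cosh (t $ i) *\<^sub>R k $ Inl i $ Inl j + sinh (t $ i) *\<^sub>R k $ Inr (Inl i) $ Inr (Inl j)"
  by (simp add: y_mat_def upper_block_def lower_block_def of_real_def mult_sigma0_nth adj_sigma0_mult_nth)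

lemma block_diag_nth [simp]:
  "block_diag u v $ Inl i $ Inl j = u $ i $ j" "block_diag u v $ Inr k $ Inr l = v $ k $ l"
  "block_diag u v $ Inl i $ Inr l = 0" "block_diag u v $ Inr k $ Inl j = 0"
  by (simp_all add: block_diag_def)

lemma a_mat_block_diag_cayley_nth:
  "(a_mat t ** block_diag u v ** cayley) $ Inl i $ Inl j = root_half *\<^sub>R y_mat t (block_diag u v) $ i $ j"
  by (simp add: a_mat_mult_nth(1) y_mat_nth scaleR_add_right mult.commute flip: matrix_mul_assoc)

text \<open>
  The group \<open>N\<close> maps the span of the weight vectors of the weights \<open>t\<^sub>k\<close> to itself, by a unitriangular matrix \<open>T\<close>; the group
  \<open>A\<close> scales these vectors by \<open>exp (s\<^sub>k)\<close>; and the top block of \<open>K\<close> acts by \<open>u'\<close>.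
\<close>

lemma y_mat_of_iwasawa:
  fixes s t :: "real^('q::{finite,linorder})" and v :: "'a::rch^('q + 'r::finite)^('q + 'r)"
  assumes eq: "a_mat t ** block_diag u v = block_diag u' v' ** mexp (H_mat s) ** n" and n: "n \<in> grp_N"
  shows "\<exists>T. raises height (T - mat 1) \<and> y_mat t (block_diag u v) = u' ** diag (\<chi> i. exp (s $ i)) ** T"
proof -
  let ?T = "(\<chi> i j. wmat n $ Inl i $ Inl j) :: 'a^('q::{finite,linorder})^('q::{finite,linorder})"
  note W = unipotent_nth[OF grp_N_unipotent[OF n]]
  have "raises height (?T - mat 1)"
    using grp_N_unipotent[OF n] by (auto simp: raises_def mat_def split: if_splits) fastforce+
  moreover have "y_mat t (block_diag u v) $ i $ j = (u' ** diag (\<chi> i. exp (s $ i)) ** ?T) $ i $ j" for i j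
  proof -
    have "mexp (H_mat s) ** n ** cayley = cayley ** (diag (\<chi> i. exp (weight s $ i)) ** wmat n)"
      by (simp add: mexp_H_mat a_mat_eq wmat_def matrix_mul_assoc)
    then have "a_mat t ** block_diag u v ** cayley =
        block_diag u' v' ** cayley ** diag (\<chi> i. exp (weight s $ i)) ** wmat n"
      unfolding eq by (simp add: matrix_mul_assoc[symmetric])
    then have "root_half *\<^sub>R y_mat t (block_diag u v) $ i $ j =
        (block_diag u' v' ** cayley ** diag (\<chi> i. exp (weight s $ i)) ** wmat n) $ Inl i $ Inl j"
      by (simp flip: a_mat_block_diag_cayley_nth)
    also have "\<dots> = (\<Sum>l\<in>UNIV. (block_diag u' v' ** cayley ** diag (\<chi> i. exp (weight s $ i))) $ Inl i $ Inl l * ?T $ l $ j)"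
    proof -
      have "wmat n $ Inr (Inl l) $ Inl j = 0" for l
        using W[of "Inl j" "Inr (Inl l)"] height_pos[of j] height_pos[of l] by simp
      then have "(P ** wmat n) $ Inl i $ Inl j = (\<Sum>l\<in>UNIV. P $ Inl i $ Inl l * ?T $ l $ j)"
        for P :: "('a, 'q, 'r) gmat"
        using height_pos[of j] by (simp add: matrix_matrix_mult_def[of P] sum_UNIV_sum W)
      then show ?thesis .
    qed
    also have "\<dots> = root_half *\<^sub>R (u' ** diag (\<chi> i. exp (s $ i)) ** ?T) $ i $ j"
      by (simp add: matrix_matrix_mult_def[of _ ?T] scaleR_sum_right)
    finally show ?thesis by (simp add: root_half_def)
  qed
  then have "y_mat t (block_diag u v) = u' ** diag (\<chi> i. exp (s $ i)) ** ?T"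
    by (simp add: vec_eq_iff)
  ultimately show ?thesis by blast
qed

lemma minor_x_mat_of_iwasawa:
  fixes s t :: "real^('q::{finite,linorder})" and k k' :: "('a::rch, 'q, 'r::finite) gmat"
  assumes k: "k \<in> grp_K" and k': "k' \<in> grp_K" and n: "n \<in> grp_N"
    and eq: "a_mat t ** k = k' ** mexp (H_mat s) ** n"
  shows "minor {..r} (x_mat t k) = of_real (exp (2 * (\<Sum>i\<le>r. s $ i)))"
proof -
  obtain u v where uv: "k = block_diag u v" using k by (auto simp: grp_K_def)
  obtain u' v' where uv': "k' = block_diag u' v'" "u' \<in> unitary" using k' by (auto simp: grp_K_def)
  obtain T where T: "raises height (T - mat 1)" and y: "y_mat t k = u' ** diag (\<chi> i. exp (s $ i)) ** T"
    using y_mat_of_iwasawa[OF eq[unfolded uv uv'] n] by (auto simp: uv)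
  have "x_mat t k = adj T ** diag (\<chi> i. exp (s $ i)) ** (adj u' ** u') ** diag (\<chi> i. exp (s $ i)) ** T"
    by (simp add: x_mat_eq y matrix_mul_assoc)
  also have "\<dots> = adj T ** (diag (\<chi> i. exp (s $ i)) ** diag (\<chi> i. exp (s $ i))) ** T"
    using uv'(2) by (simp add: unitary_def matrix_mul_assoc)
  also have "\<dots> = adj T ** diag (\<chi> i. exp (2 * s $ i)) ** T"
    by (simp add: diag_mult_diag flip: exp_add)
  finally have "minor {..r} (x_mat t k) = of_real (\<Prod>i\<le>r. exp (2 * s $ i))"
    by (simp add: minor_gram_triangular[OF T])
  then show ?thesis
    by (simp add: exp_sum sum_distrib_left)
qed

section \<open>Existence of the Iwasawa decomposition\<close>

text \<open>
  One Gram--Schmidt step, by orthogonal projection for the real inner product onto the span of the earlier columns. That span is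
  closed under right multiplication by scalars, so the residue is orthogonal to it for the scalar-valued
  product as well.
\<close>

lemma orthogonalize_column:
  fixes y :: "'a::rch^('q::{finite,linorder})^'n"
  obtains c where "\<And>i. j < i \<Longrightarrow> c $ i = 0" "c $ j = 1" "\<And>i. i < j \<Longrightarrow> (adj y *v (y *v c)) $ i = 0"
proof -
  \<comment> \<open>Coefficient vectors supported strictly before \<open>j\<close>.\<close>
  define V where "V = {c :: 'a^('q::{finite,linorder}). \<forall>i. c $ i \<noteq> 0 \<longrightarrow> i < j}"
  define W where "W = (*v) y ` V"
  have "subspace V"
    by (auto simp: subspace_def V_def) (metis add.right_neutral)
  then have W: "subspace W"
    unfolding W_def by (rule linear_subspace_image[OF matrix_vector_mul_linear])
  obtain a b where a: "a \<in> span W" and b: "\<And>w. w \<in> span W \<Longrightarrow> orthogonal b w"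
    and ab: "y *v axis j 1 = a + b"
    using orthogonal_subspace_decomp_exists by metis
  obtain c0 where c0: "c0 \<in> V" "a = y *v c0"
  proof -
    have "a \<in> W" using a W by (metis span_eq_iff)
    then show ?thesis using that by (auto simp: W_def)
  qed
  let ?c = "axis j 1 - c0"
  have bc: "b = y *v ?c"
    using ab c0(2) by (simp add: matrix_vector_mult_diff_distrib algebra_simps)
  show ?thesis
  proof (rule that[of ?c])
    show "?c $ i = 0" if "j < i" for i
      using c0(1) that by (auto simp: V_def axis_def)
    show "?c $ j = 1"
      using c0(1) by (auto simp: V_def axis_def)
    show "(adj y *v (y *v ?c)) $ i = 0" if "i < j" for i
    proof -
      have "inner a ((adj y *v b) $ i) = 0" for a
      proof -
        have "axis i a \<in> V" using that by (auto simp: V_def axis_def split: if_splits)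
        then have "y *v axis i a \<in> span W" by (intro span_base) (simp add: W_def)
        then have "inner (y *v axis i a) b = 0"
          using b by (metis orthogonal_def inner_commute)
        then show ?thesis
          by (simp add: inner_matrix_vector_adj inner_axis')
      qed
      then show ?thesis
        using inner_eq_zero_iff bc by blast
    qed
  qed
qed

lemma adj_mult_self_nth_self: "(adj Q ** Q) $ j $ j = of_real (\<Sum>i\<in>UNIV. (norm (Q $ i $ j))\<^sup>2)"
  by (simp add: matrix_matrix_mult_def conj_mult_self)

text \<open>
  The Gram matrix of the orthogonalized columns vanishes above the diagonal by construction and below it
  because it is Hermitian. Its diagonal entries are squared lengths, nonzero by injectivity.
\<close>

lemma gram_schmidt:
  fixes y :: "'a::rch^('q::{finite,linorder})^('q::{finite,linorder})"
  assumes inj: "\<And>x. y *v x = 0 \<Longrightarrow> x = 0"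
  obtains S u s where "raises height (S - mat 1)" "u \<in> unitary" "y ** S = u ** diag (\<chi> i. exp (s $ i))"
proof -
  have "\<exists>c. (\<forall>i. j < i \<longrightarrow> c $ i = 0) \<and> c $ j = 1 \<and> (\<forall>i<j. (adj y *v (y *v c)) $ i = 0)" for j
    using orthogonalize_column[of j y] by metis
  then obtain C where C: "\<And>i j. j < i \<Longrightarrow> C j $ i = 0" "\<And>j. C j $ j = 1"
      "\<And>i j. i < j \<Longrightarrow> (adj y *v (y *v C j)) $ i = 0"
    by metis
  define S :: "'a^('q::{finite,linorder})^('q::{finite,linorder})" where "S = (\<chi> i j. C j $ i)"
  have "raises height (S - mat 1)"
    unfolding raises_def S_def using C by (auto simp: mat_def) (metis linorder_cases)+
  define Q where "Q = y ** S"
  have Qcol: "(A ** S) $ i $ j = (A *v C j) $ i" for A :: "'a^('q::{finite,linorder})^('q::{finite,linorder})" and i j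
    by (simp add: matrix_matrix_mult_def matrix_vector_mult_def S_def)
  have up: "(adj Q ** Q) $ i $ j = 0" if "i < j" for i j
  proof -
    have "(adj Q ** Q) $ i $ j = (adj S ** (adj y ** y ** S)) $ i $ j"
      by (simp add: Q_def matrix_mul_assoc)
    also have "\<dots> = (\<Sum>k\<in>UNIV. conj (C i $ k) * (adj y *v (y *v C j)) $ k)"
      by (subst matrix_matrix_mult_def) (simp add: Qcol matrix_vector_mul_assoc, simp add: S_def)
    also have "\<dots> = 0"
    proof (rule sum.neutral, rule ballI)
      fix k
      show "conj (C i $ k) * (adj y *v (y *v C j)) $ k = 0"
        using C(1)[of i k] C(3)[of k j] that by (cases "k < j") auto
    qed
    finally show ?thesis .
  qed
  have down: "(adj Q ** Q) $ i $ j = 0" if "j < i" for i j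
  proof -
    have "adj (adj Q ** Q) $ i $ j = conj ((adj Q ** Q) $ j $ i)"
      by (simp only: adj_nth)
    then show ?thesis using up[OF that] by simp
  qed
  define d where "d j = (\<Sum>i\<in>UNIV. (norm (Q $ i $ j))\<^sup>2)" for j
  have "0 < d j" for j
  proof -
    have "C j \<noteq> 0" using C(2)[of j] by auto
    then have "y *v C j \<noteq> 0" using inj by blast
    then obtain i where "Q $ i $ j \<noteq> 0"
      unfolding Q_def Qcol by (auto simp: vec_eq_iff)
    then show ?thesis
      unfolding d_def by (intro sum_pos2[of _ i]) auto
  qed
  have "adj Q ** Q = diag (\<chi> j. d j)"
    unfolding vec_eq_iff diag_def d_def
    using up down by (auto simp: adj_mult_self_nth_self) (metis linorder_cases)
  define s :: "real^('q::{finite,linorder})" where "s = (\<chi> j. ln (d j) / 2)"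
  define u where "u = Q ** diag (\<chi> j. exp (- s $ j))"
  have "adj u ** u = diag (\<chi> j. exp (- s $ j)) ** (adj Q ** Q) ** diag (\<chi> j. exp (- s $ j))"
    by (simp add: u_def matrix_mul_assoc)
  also have "\<dots> = mat 1"
  proof -
    have "exp (- s $ j) * d j * exp (- s $ j) = 1" for j
    proof -
      have "exp (- s $ j) * d j * exp (- s $ j) = exp (- s $ j + ln (d j) + - s $ j)"
        using \<open>0 < d j\<close> by (simp only: exp_add exp_ln)
      then show ?thesis by (simp add: s_def)
    qed
    then show ?thesis
      unfolding \<open>adj Q ** Q = diag (\<chi> j. d j)\<close> by (simp add: diag_mult_diag flip: diag_1)
  qed
  finally have "u \<in> unitary" by (simp add: unitary_def)
  moreover have "y ** S = u ** diag (\<chi> j. exp (s $ j))"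
    unfolding u_def Q_def[symmetric]
    by (simp add: diag_mult_diag diag_1 flip: matrix_mul_assoc exp_add)
  ultimately show ?thesis
    using \<open>raises height (S - mat 1)\<close> that by blast
qed

lemma grp_K_pseudo_unitary: "k \<in> grp_K \<Longrightarrow> k \<in> pseudo_unitary"
  by (auto simp: grp_K_def block_diag_pseudo_unitary_iff)

text \<open>
  A kernel vector \<open>x\<close> yields a combination of isotropic weight vectors whose image \<open>z\<close> under the isometry has vanishing
  top block. The form vanishes at \<open>z\<close> and is negative definite on vectors with vanishing top block, so \<open>z\<close> and
  \<open>x\<close> are zero.
\<close>

lemma y_mat_inj:
  fixes u :: "'a::rch^('q::finite)^('q::finite)" and v :: "'a^('q + 'r::finite)^('q + 'r)"
  assumes uv: "u \<in> unitary" "v \<in> unitary" and x: "y_mat t (block_diag u v) *v x = 0"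
  shows "x = 0"
proof -
  define w :: "'a^('q + ('q + 'r))" where "w = (\<chi> i. case i of Inl j \<Rightarrow> x $ j | _ \<Rightarrow> 0)"
  define g where "g = a_mat t ** block_diag u v"
  have g: "g \<in> pseudo_unitary"
    using uv unfolding g_def
    by (intro pseudo_unitary_mult a_mat_pseudo_unitary) (simp add: block_diag_pseudo_unitary_iff)
  define z where "z = (g ** cayley) *v w"
  have "z $ Inl i = root_half *\<^sub>R (y_mat t (block_diag u v) *v x) $ i" for i
    by (simp add: z_def g_def w_def matrix_vector_mult_def sum_UNIV_sum a_mat_block_diag_cayley_nth
        scaleR_sum_right del: mult_cayley_nth)
  then have zl: "z $ Inl i = 0" for i by (simp add: x)
  have cw: "(cayley *v w) $ Inl i = root_half *\<^sub>R x $ i" "(cayley *v w) $ Inr (Inl i) = root_half *\<^sub>R x $ i"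
    "(cayley *v w) $ Inr (Inr l) = 0" for i l
    by (simp_all add: w_def matrix_vector_mult_def sum_UNIV_sum cayley_nth if_distrib if_distribR of_real_def cong: if_cong)
  have "form z = form (cayley *v w)"
    using form_pseudo_unitary[OF g] by (simp add: z_def flip: matrix_vector_mul_assoc)
  also have "\<dots> = 0"
    by (simp add: form_def sum_UNIV_sum cw)
  finally have "(\<Sum>j\<in>UNIV. (norm (z $ Inr j))\<^sup>2) = 0"
    by (simp add: form_def zl)
  then have "z $ Inr j = 0" for j
    by (simp add: sum_nonneg_eq_0_iff)
  with zl have "z = 0"
    by (simp add: vec_eq_iff all_sum_type)
  have "(cayley ** form_adj g ** (g ** cayley)) *v w = 0"
    using \<open>z = 0\<close> by (simp add: z_def flip: matrix_vector_mul_assoc)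
  moreover have "cayley ** form_adj g ** (g ** cayley) = mat 1"
  proof -
    have "cayley ** form_adj g ** (g ** cayley) = cayley ** (form_adj g ** g) ** cayley"
      by (simp add: matrix_mul_assoc)
    then show ?thesis by (simp add: form_adj_mult[OF g] cayley_mult_self)
  qed
  ultimately have "w = 0" by simp
  then show "x = 0" by (simp add: vec_eq_iff w_def all_sum_type)
qed

lemma unipotent_inverse:
  fixes A B :: "'a::rch^'n^'n"
  assumes A: "raises lv (A - mat 1)" and AB: "A ** B = mat 1"
  shows "raises lv (B - mat 1)"
proof -
  note nilA = raises_imp_nilpotent[OF A]
  define L where "L = fps_mat fps_log1p (A - mat 1)"
  have rL: "raises lv L"
    unfolding L_def by (rule raises_fps_mat[OF A fps_log1p_0])
  have "mexp L = A"
    by (simp add: L_def mexp_fps_log1p[OF nilA])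
  then have "mexp (- L) ** A = mat 1"
    using mexp_minus_mult[OF raises_imp_nilpotent[OF rL]] by simp
  then have "mexp (- L) = B"
  proof -
    have "mexp (- L) = mexp (- L) ** (A ** B)" by (simp add: AB)
    also have "\<dots> = mexp (- L) ** A ** B" by (simp add: matrix_mul_assoc)
    finally show ?thesis using \<open>mexp (- L) ** A = mat 1\<close> by simp
  qed
  moreover have "raises lv (- L)"
    using rL by (simp add: raises_def)
  ultimately show ?thesis
    using raises_mexp by metis
qed

text \<open>
  For an isometry, the columns of nonnegative level determine the diagonal block of the others: the block on
  negative levels is the inverse of \<open>S\<^sup>*\<close>, hence unitriangular in the opposite order. The remaining entries of these
  columns raise the level whatever their value.
\<close>

lemma pseudo_unitary_unipotent:
  fixes W :: "('a::rch, 'q::{finite,linorder}, 'r::finite) gmat"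
  assumes pu: "adj W ** wmat (diag form_signs) ** W = wmat (diag form_signs)"
    and S: "raises height (S - mat 1)"
    and W1: "\<And>i j. W $ Inl i $ Inl j = S $ i $ j" "\<And>i j. W $ Inr i $ Inl j = 0"
    and W2: "\<And>j l. W $ Inr (Inl j) $ Inr (Inr l) = 0" "\<And>m l. W $ Inr (Inr m) $ Inr (Inr l) = (if m = l then 1 else 0)"
  shows "raises level (W - mat 1)"
proof -
  define B where "B = (\<chi> i j. W $ Inr (Inl i) $ Inr (Inl j))"
  have "adj S ** B = mat 1"
  proof -
    have "(adj S ** B) $ i $ j = (mat 1 :: 'a^('q::{finite,linorder})^('q::{finite,linorder})) $ i $ j" for i j
    proof -
      have "(adj S ** B) $ i $ j = (adj W ** wmat (diag form_signs) ** W) $ Inl i $ Inr (Inl j)"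
        by (simp add: matrix_mul_assoc[symmetric])
           (simp add: matrix_matrix_mult_def[of "adj _"] sum_UNIV_sum wmat_form_signs_mult_nth W1 B_def)
      also have "\<dots> = mat 1 $ i $ j"
        unfolding pu by (simp add: wmat_form_signs mat_def)
      finally show ?thesis .
    qed
    then show ?thesis by (simp add: vec_eq_iff)
  qed
  moreover have "raises (\<lambda>i. - height i) (adj S - mat 1)"
    unfolding raises_def
  proof (intro allI impI)
    fix i j assume "(adj S - mat 1) $ i $ j \<noteq> 0"
    then have "(S - mat 1) $ j $ i \<noteq> 0" by (auto simp: mat_def split: if_splits)
    then show "- height j < - height i" using S by (auto simp: raises_def)
  qed
  ultimately have B: "raises (\<lambda>i. - height i) (B - mat 1)"
    using unipotent_inverse by blast
  have pp: "- height i < height j" "- height i < 0" "0 < height i" for i j :: 'q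
    using height_pos[of i] height_pos[of j] by linarith+
  show ?thesis
    using S B W1 W2
    unfolding raises_def all_sum_type
    by (simp add: mat_def B_def pp)
qed

text \<open>
  Over the reals \<open>K\<close> requires both blocks to have determinant 1, and the determinant of the product alone does not decide
  the signs. Along the path \<open>c *\<^sub>R t\<close> the matrix \<open>y_mat\<close> stays invertible and starts at \<open>u\<close>, so its determinant remains
  positive; \<open>u'\<close> has the same sign by the unitriangular factorization.
\<close>

lemma cdet_eq_1_of_unitary_path:
  fixes u :: "'a::rch^('q::{finite,linorder})^('q::{finite,linorder})" and v :: "'a^('q + 'r::finite)^('q + 'r)"
  assumes d: "DIM('a) = 1" and uv: "u \<in> unitary" "v \<in> unitary" and u1: "cdet UNIV u = 1"
    and u': "u' \<in> unitary" and S: "raises height (S - mat 1)"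
    and yS: "y_mat t (block_diag u v) ** S = u' ** diag (\<chi> i. exp (s $ i))"
  shows "cdet UNIV u' = 1"
proof -
  let ?y = "\<lambda>c :: real. y_mat (c *\<^sub>R t) (block_diag u v)"
  \<comment> \<open>Over the reals the adjoint is the transpose, so the square of such a determinant is 1.\<close>
  have unit: "cdet UNIV w * cdet UNIV w = 1" if "w \<in> unitary" for w :: "'a^('q::{finite,linorder})^('q::{finite,linorder})"
  proof -
    have cnj: "cpart1 (conj x) = cpart1 x" for x :: 'a
      using cpart1_Reals[OF d, of x] by (simp add: cpart1_def quat_of_conj qcnj_def complex_is_Real_iff)
    have "cmatrix (adj w) = transpose (cmatrix w)"
      by (simp add: vec_eq_iff cmatrix_def transpose_def cnj)
    then have "cdet UNIV (adj w) = cdet UNIV w"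
      using d by (simp add: cdet_def det_on_UNIV)
    moreover have "cdet UNIV (adj w) * cdet UNIV w = 1"
      using that by (simp add: unitary_def flip: cdet_mult)
    ultimately show ?thesis by simp
  qed
  define f where "f c = Re (cdet UNIV (?y c))" for c
  have f: "cdet UNIV (?y c) = of_real (f c)" for c
    unfolding f_def by (simp only: of_real_Re[OF cdet_Reals[OF d]])
  have decomp: "\<exists>e (w :: 'a^('q::{finite,linorder})^('q::{finite,linorder})). e > 0 \<and> w \<in> unitary \<and> cdet UNIV (?y c) = cdet UNIV w * of_real e" for c
  proof -
    obtain S' w s' where *: "raises height (S' - mat 1)" "w \<in> unitary" "?y c ** S' = w ** diag (\<chi> i. exp (s' $ i))"
      using gram_schmidt[of "?y c"] y_mat_inj[OF uv] by metis
    then have "cdet UNIV (?y c ** S') = cdet UNIV (w ** diag (\<chi> i. exp (s' $ i)))" by simp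
    then have "cdet UNIV (?y c) = cdet UNIV w * of_real (\<Prod>i\<in>UNIV. exp (s' $ i))"
      using d by (simp add: cdet_mult cdet_diag cdet_unipotent[OF *(1)])
    then show ?thesis
      using *(2) by (intro exI[of _ "\<Prod>i\<in>UNIV. exp (s' $ i)"] exI[of _ w]) (simp add: prod_pos)
  qed
  have nz: "f c \<noteq> 0" for c
  proof
    assume "f c = 0"
    with decomp[of c] f[of c] obtain w :: "'a^('q::{finite,linorder})^('q::{finite,linorder})" where "w \<in> unitary" "cdet UNIV w = 0" by auto
    then show False using unit by force
  qed
  have "?y 0 = u"
    by (simp add: vec_eq_iff y_mat_nth)
  then have f0: "f 0 = 1" by (simp add: f_def u1)
  have cont: "continuous_on {0..1} f"
    unfolding f_def
    by (intro continuous_on_Re continuous_on_cdet) (use d in \<open>auto simp: y_mat_nth intro!: continuous_intros\<close>)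
  have "f 1 > 0"
  proof (rule ccontr)
    assume "\<not> f 1 > 0"
    then have "\<exists>c. 0 \<le> c \<and> c \<le> 1 \<and> f c = 0"
      using IVT2'[of f 1 0 0] cont f0 by auto
    then show False using nz by blast
  qed
  have "cdet UNIV (?y 1 ** S) = cdet UNIV (u' ** diag (\<chi> i. exp (s $ i)))"
    using yS by simp
  then have "of_real (f 1) = cdet UNIV u' * of_real (\<Prod>i\<in>UNIV. exp (s $ i))"
    using d by (simp only: cdet_mult cdet_diag cdet_unipotent[OF S] f) simp
  moreover have "cdet UNIV u' = of_real (Re (cdet UNIV u'))"
    by (simp only: of_real_Re[OF cdet_Reals[OF d]])
  ultimately have "of_real (f 1) = (of_real (Re (cdet UNIV u') * (\<Prod>i\<in>UNIV. exp (s $ i))) :: complex)"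
    by simp
  then have "f 1 = Re (cdet UNIV u') * (\<Prod>i\<in>UNIV. exp (s $ i))"
    by (simp only: of_real_eq_iff)
  moreover have "(\<Prod>i\<in>UNIV. exp (s $ i)) > 0" by (simp add: prod_pos)
  ultimately have "Re (cdet UNIV u') > 0"
    using \<open>f 1 > 0\<close> by (simp add: zero_less_mult_iff)
  moreover have "cdet UNIV u' = 1 \<or> cdet UNIV u' = -1"
    using unit[OF u'] by (simp add: square_eq_1_iff)
  ultimately show ?thesis by auto
qed

text \<open>
  The factor in \<open>K\<close> is constructed from the images under \<open>g\<close> of suitable combinations of weight vectors. Gram--Schmidt
  on the top block of the images of the isotropic vectors gives \<open>u'\<close>, the triangular matrix \<open>S\<close> and the scaling \<open>s\<close>.
  The vectors of weight zero are corrected by isotropic vectors, with coefficients \<open>c\<close>, so that the top block of their images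
  vanishes. Since \<open>g\<close> preserves the form, the bottom blocks of all these images are orthonormal and constitute \<open>v'\<close>.
  Then \<open>g\<^sup>-\<^sup>1 k' a\<close> is an isometry that is unitriangular on the columns so treated, hence the inverse of an element of \<open>N\<close>.
\<close>

lemma iwasawa_exists:
  fixes t :: "real^('q::{finite,linorder})" and k :: "('a::rch, 'q, 'r::finite) gmat"
  assumes k: "k \<in> grp_K"
  shows "\<exists>s. \<exists>k'\<in>grp_K. \<exists>n\<in>grp_N. a_mat t ** k = k' ** mexp (H_mat s) ** n"
proof -
  obtain u v where uv: "k = block_diag u v" "u \<in> unitary" "v \<in> unitary"
    and det: "if DIM('a) = 1 then Det u = 1 \<and> Det v = 1 else if DIM('a) = 2 then Det u * Det v = 1 else True"
    using k by (auto simp: grp_K_def)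
  let ?y = "y_mat t (block_diag u v)"
  define g where "g = a_mat t ** k"
  have g: "g \<in> pseudo_unitary"
    unfolding g_def by (intro pseudo_unitary_mult a_mat_pseudo_unitary grp_K_pseudo_unitary k)
  have y_inj: "?y *v x = 0 \<Longrightarrow> x = 0" for x
    by (rule y_mat_inj[OF uv(2,3)])
  obtain S u' s where S: "raises height (S - mat 1)" and u': "u' \<in> unitary"
    and yS: "?y ** S = u' ** diag (\<chi> i. exp (s $ i))"
    using gram_schmidt[OF y_inj] by metis
  have "surj ((*v) ?y)"
  proof -
    have "inj ((*v) ?y)"
      using linear_injective_0[OF matrix_vector_mul_linear[of ?y]] y_inj by blast
    then show ?thesis
      using linear_injective_imp_surjective[OF matrix_vector_mul_linear] by blast
  qed
  then have "\<forall>l. \<exists>c. (\<chi> i. - (g ** cayley) $ Inl i $ Inr (Inr l)) = ?y *v c"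
    by (intro allI) (erule surjD)
  from choice[OF this] obtain c where c: "\<And>l. ?y *v c l = (\<chi> i. - (g ** cayley) $ Inl i $ Inr (Inr l))"
    by auto
  \<comment> \<open>The columns at \<open>Inr (Inl _)\<close> are left zero: the isometry determines the images of these weight vectors.\<close>
  define E :: "('a, 'q, 'r) gmat" where "E = (\<chi> i j. case (i, j) of
      (Inl a, Inl b) \<Rightarrow> S $ a $ b
    | (Inl a, Inr (Inr l)) \<Rightarrow> (1 / root_half) *\<^sub>R c l $ a
    | (Inr (Inr m), Inr (Inr l)) \<Rightarrow> if m = l then 1 else 0
    | _ \<Rightarrow> 0)"
  \<comment> \<open>Normalizes the isotropic columns of \<open>E\<close>, so that the top block of \<open>F\<close> is \<open>u'\<close> itself.\<close>
  define rescale :: "real^('q + ('q + 'r))" where "rescale = (\<chi> j. case j of Inl b \<Rightarrow> exp (- s $ b) / root_half | _ \<Rightarrow> 1)"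
  define F where "F = g ** cayley ** (E ** diag rescale)"
  have E_nth: "E $ Inl a $ Inl b = S $ a $ b" "E $ Inr (Inl a) $ Inl b = 0" "E $ Inr (Inr m) $ Inl b = 0"
    "E $ Inl a $ Inr (Inr l) = (1 / root_half) *\<^sub>R c l $ a" "E $ Inr (Inl a) $ Inr (Inr l) = 0"
    "E $ Inr (Inr m) $ Inr (Inr l) = (if m = l then 1 else 0)" for a b l m
    by (simp_all add: E_def)
  have rescale_nth: "rescale $ Inl b = exp (- s $ b) / root_half" "rescale $ Inr j = 1" for b j
    by (simp_all add: rescale_def)
  have rh: "root_half \<noteq> 0" by (simp add: root_half_def)
  have F_top: "F $ Inl a $ Inl b = u' $ a $ b" for a b
  proof -
    have "F $ Inl a $ Inl b = (g ** cayley ** E) $ Inl a $ Inl b * of_real (exp (- s $ b) / root_half)"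
      by (simp only: F_def matrix_mul_assoc mult_diag_nth rescale_nth)
    also have "(g ** cayley ** E) $ Inl a $ Inl b = root_half *\<^sub>R (?y ** S) $ a $ b"
      by (simp add: matrix_matrix_mult_def[of _ E] matrix_matrix_mult_def[of _ S] sum_UNIV_sum E_nth g_def uv(1)
          a_mat_block_diag_cayley_nth scaleR_sum_right del: mult_cayley_nth)
    also have "(?y ** S) $ a $ b = exp (s $ b) *\<^sub>R u' $ a $ b"
      by (simp add: yS of_real_def)
    finally show ?thesis
      using rh by (simp add: of_real_def exp_minus)
  qed
  have F_top0: "F $ Inl a $ Inr (Inr l) = 0" for a l
  proof -
    have "F $ Inl a $ Inr (Inr l) = (g ** cayley ** E) $ Inl a $ Inr (Inr l)"
      by (simp only: F_def matrix_mul_assoc mult_diag_nth rescale_nth) simp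
    also have "\<dots> = (?y *v c l) $ a + (g ** cayley) $ Inl a $ Inr (Inr l)"
      using rh by (simp add: matrix_matrix_mult_def[of _ E] matrix_vector_mult_def sum_UNIV_sum E_nth g_def uv(1)
          a_mat_block_diag_cayley_nth scaleR_sum_right if_distrib cong: if_cong del: mult_cayley_nth)
    also have "\<dots> = 0" by (simp add: c)
    finally show ?thesis .
  qed
  define col :: "'q + 'r \<Rightarrow> 'q + ('q + 'r)" where "col b = (case b of Inl j \<Rightarrow> Inl j | Inr l \<Rightarrow> Inr (Inr l))" for b
  have col_simps [simp]: "col (Inl j) = Inl j" "col (Inr l) = Inr (Inr l)" for j l
    by (simp_all add: col_def)
  define v' :: "'a^('q + 'r)^('q + 'r)" where "v' = (\<chi> a b. F $ Inr a $ col b)"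
  \<comment> \<open>The columns at \<open>Inl _\<close> span an isotropic subspace orthogonal to those at \<open>Inr (Inr _)\<close>, which are orthonormal up to sign.\<close>
  have gram: "(adj F ** diag form_signs ** F) $ col a $ col b = (if a = b \<and> \<not> isl a then -1 else 0)" for a b
  proof -
    have "adj F ** diag form_signs ** F = adj (E ** diag rescale) ** wmat (adj g ** diag form_signs ** g) ** (E ** diag rescale)"
      by (simp add: F_def wmat_def matrix_mul_assoc)
    also have "adj g ** diag form_signs ** g = diag form_signs"
      using g by (simp add: pseudo_unitary_def)
    finally have "(adj F ** diag form_signs ** F) $ col a $ col b =
        (\<Sum>i\<in>UNIV. conj ((E ** diag rescale) $ i $ col a) * (of_real (dual_sign i) * (E ** diag rescale) $ opposite i $ col b))"
      by (simp only: matrix_mul_assoc[symmetric])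
         (simp only: matrix_matrix_mult_def[of "adj _" "wmat _ ** _"] vec_lambda_beta adj_nth wmat_form_signs_mult_nth)
    also have "\<dots> = (if a = b \<and> \<not> isl a then -1 else 0)"
    proof -
      have EX: "(E ** diag rescale) $ Inr (Inl i) $ Inl j = 0" "(E ** diag rescale) $ Inr (Inl i) $ Inr (Inr l) = 0" "(E ** diag rescale) $ Inr (Inr m) $ Inl j = 0"
        "(E ** diag rescale) $ Inr (Inr m) $ Inr (Inr l) = (if m = l then 1 else 0)" for i j m l
        by (simp_all add: E_nth rescale_nth)
      have "conj (if k = m then 1 else 0) * (- (if k = l then 1 else 0)) =
          (if k = m then if m = l then -1 else 0 else (0 :: 'a))" for k m l :: 'r
        by simp
      then show ?thesis
        by (cases a; cases b) (simp_all add: sum_UNIV_sum EX del: mult_diag_nth)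
    qed
    finally show ?thesis .
  qed
  have v': "v' \<in> unitary"
  proof -
    have "(adj v' ** v') $ a $ b = (mat 1 :: 'a^('q + 'r)^('q + 'r)) $ a $ b" for a b
    proof -
      have "(adj F ** diag form_signs ** F) $ col a $ col b =
          (\<Sum>i\<in>UNIV. conj (F $ Inl i $ col a) * F $ Inl i $ col b) - (adj v' ** v') $ a $ b"
        by (simp only: matrix_mul_assoc[symmetric])
           (simp add: matrix_matrix_mult_def[of "adj _"] sum_UNIV_sum v'_def sum_negf)
      moreover have "(\<Sum>i\<in>UNIV. conj (F $ Inl i $ col a) * F $ Inl i $ col b) =
          (if a = b \<and> isl a then 1 else 0)"
      proof -
        have "(adj u' ** u') $ i $ j = (if i = j then 1 else 0)" for i j
          using u' by (simp add: unitary_def mat_def)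
        then have "(\<Sum>l\<in>UNIV. conj (u' $ l $ i) * u' $ l $ j) = (if i = j then 1 else 0)" for i j
          by (simp add: matrix_matrix_mult_def)
        then show ?thesis
          by (cases a; cases b) (simp_all add: F_top F_top0)
      qed
      ultimately show ?thesis
        unfolding gram by (auto simp: mat_def algebra_simps split: if_splits)
    qed
    then show ?thesis by (simp add: unitary_def vec_eq_iff)
  qed
  define k' :: "('a, 'q, 'r) gmat" where "k' = block_diag u' v'"
  have k'_pu: "k' \<in> pseudo_unitary"
    using u' v' by (simp add: k'_def block_diag_pseudo_unitary_iff)
  define m where "m = form_adj g ** k' ** a_mat s"
  have m_pu: "m \<in> pseudo_unitary"
    unfolding m_def by (intro pseudo_unitary_mult form_adj_pseudo_unitary g k'_pu a_mat_pseudo_unitary)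
  have gm: "g ** m = k' ** a_mat s"
    by (simp add: m_def matrix_mul_assoc mult_form_adj[OF g])
  have W_col: "wmat m $ i $ col b = E $ i $ col b" for i b
  proof -
    have "g ** cayley ** wmat m = k' ** cayley ** diag (\<chi> i. exp (weight s $ i))"
    proof -
      have "g ** cayley ** wmat m = g ** m ** cayley"
        by (simp add: wmat_def matrix_mul_assoc)
      then show ?thesis
        unfolding gm by (simp add: a_mat_eq wmat_def matrix_mul_assoc)
    qed
    moreover have "(k' ** cayley ** diag (\<chi> i. exp (weight s $ i))) $ i $ col b = (g ** cayley ** E) $ i $ col b" for i
    proof -
      have "F $ i $ col b = (g ** cayley ** E) $ i $ col b * of_real (rescale $ col b)"
        by (simp only: F_def matrix_mul_assoc mult_diag_nth)
      moreover have "rescale $ col b \<noteq> 0" using rh by (cases b) (simp_all add: rescale_nth)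
      ultimately have "(g ** cayley ** E) $ i $ col b = F $ i $ col b * of_real (inverse (rescale $ col b))"
        by (simp add: mult.assoc)
      moreover have "(k' ** cayley ** diag (\<chi> i. exp (weight s $ i))) $ i $ col b = F $ i $ col b * of_real (inverse (rescale $ col b))"
        by (cases b; cases i)
           (simp_all add: k'_def v'_def F_top F_top0 rescale_nth of_real_def exp_minus field_simps)
      ultimately show ?thesis by simp
    qed
    ultimately have col_eq: "(g ** cayley ** wmat m) $ i $ col b = (g ** cayley ** E) $ i $ col b" for i
      by simp
    have inv: "cayley ** form_adj g ** (g ** cayley ** X) = X" for X :: "('a, 'q, 'r) gmat"
    proof -
      have "cayley ** form_adj g ** (g ** cayley ** X) = cayley ** (form_adj g ** g) ** cayley ** X"
        by (simp add: matrix_mul_assoc)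
      then show ?thesis by (simp add: form_adj_mult[OF g] cayley_mult_self)
    qed
    have "(cayley ** form_adj g ** (g ** cayley ** wmat m)) $ i $ col b = (cayley ** form_adj g ** (g ** cayley ** E)) $ i $ col b"
      by (simp add: matrix_matrix_mult_def[of "cayley ** form_adj g"] col_eq del: cayley_mult_nth mult_cayley_nth)
    then show ?thesis by (simp only: inv)
  qed
  have "raises level (wmat m - mat 1)"
  proof (rule pseudo_unitary_unipotent[OF _ S])
    show "adj (wmat m) ** wmat (diag form_signs) ** wmat m = wmat (diag form_signs)"
      using m_pu by (simp add: adj_wmat pseudo_unitary_def flip: wmat_mult)
    show "wmat m $ Inl i $ Inl j = S $ i $ j" for i j
      using W_col[of "Inl i" "Inl j"] by (simp add: E_nth)
    show "wmat m $ Inr i $ Inl j = 0" for i j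
      using W_col[of "Inr i" "Inl j"] by (cases i) (simp_all add: E_nth)
    show "wmat m $ Inr (Inl j) $ Inr (Inr l) = 0" for j l
      using W_col[of "Inr (Inl j)" "Inr l"] by (simp add: E_nth)
    show "wmat m $ Inr (Inr i) $ Inr (Inr l) = (if i = l then 1 else 0)" for i l
      using W_col[of "Inr (Inr i)" "Inr l"] by (simp add: E_nth)
  qed
  then obtain n where n: "n \<in> grp_N" "n ** m = mat 1"
    using unipotent_inverse_in_grp_N[OF m_pu] by blast
  have "g = g ** (m ** n)"
    using matrix_left_inverse_imp_right[OF n(2)] by simp
  then have eq: "a_mat t ** k = k' ** mexp (H_mat s) ** n"
    by (simp add: g_def[symmetric] matrix_mul_assoc gm mexp_H_mat)
  have "k' \<in> grp_K"
  proof -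
    have dets: "cdet UNIV u' * cdet UNIV v' = cdet UNIV u * cdet UNIV v" if "DIM('a) \<noteq> 4"
    proof -
      have "cdet UNIV n = 1"
        using grp_N_unipotent[OF n(1)]
        by (subst cdet_wmat[symmetric]) (rule cdet_unipotent)
      then have "cdet UNIV k = cdet UNIV k'"
        using arg_cong[OF eq, of "cdet UNIV"] by (simp add: cdet_mult cdet_a_mat mexp_H_mat)
      then show ?thesis
        using that by (simp add: uv(1) k'_def cdet_block_diag)
    qed
    consider "DIM('a) = 1" | "DIM('a) = 2" | "DIM('a) \<noteq> 1" "DIM('a) \<noteq> 2" by blast
    then have "if DIM('a) = 1 then Det u' = 1 \<and> Det v' = 1 else if DIM('a) = 2 then Det u' * Det v' = 1 else True"
    proof cases
      case 1
      then have uv1: "cdet UNIV u = 1" "cdet UNIV v = 1"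
        using det by (simp_all add: minor_eq_cdet)
      then have "cdet UNIV u' = 1"
        using cdet_eq_1_of_unitary_path[OF 1 uv(2,3) _ u' S yS] by blast
      then show ?thesis
        using 1 dets uv1 by (simp add: minor_eq_cdet)
    next
      case 2
      then show ?thesis
        using det dets by (simp add: minor_eq_cdet)
    qed simp
    then show ?thesis
      unfolding grp_K_def k'_def using u' v' by blast
  qed
  with n(1) eq show ?thesis by blast
qed

section \<open>The spherical function\<close>

text \<open>
  The value at the successor index, with the convention that the entry after the last one is 0.
\<close>

definition next_or_0 :: "'b::zero^('q::{finite,linorder}) \<Rightarrow> 'q \<Rightarrow> 'b"
  where "next_or_0 a r = (if {r<..} = {} then 0 else a $ Min {r<..})"

lemma sum_diff_next:
  fixes a :: "'b::ab_group_add^('q::{finite,linorder})"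
  shows "(\<Sum>r\<in>{i..}. a $ r - next_or_0 a r) = a $ i"
proof (induction "card {i..}" arbitrary: i rule: less_induct)
  case less
  have split: "{i..} = insert i {i<..}" by auto
  show ?case
  proof (cases "{i<..} = {}")
    case True
    then show ?thesis by (simp add: split next_or_0_def)
  next
    case False
    define j where "j = Min {i<..}"
    have "j \<in> {i<..}" unfolding j_def using False by (intro Min_in) auto
    then have j: "i < j" by simp
    have "{i<..} = {j..}"
      using j unfolding j_def by (auto intro: Min_le order_less_le_trans)
    moreover have "card {j..} < card {i..}"
      using j by (intro psubset_card_mono) auto
    ultimately have "(\<Sum>r\<in>{i<..}. a $ r - next_or_0 a r) = a $ j"
      using less[of j] by simp
    moreover have "next_or_0 a i = a $ j"
      using False by (simp add: next_or_0_def j_def)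
    ultimately show ?thesis
      by (simp add: split)
  qed
qed

text \<open>
  Exchanging the sums leaves \<open>\<Sum>r\<ge>i. a\<^sub>r - a\<^sub>r\<^sub>+\<^sub>1\<close>, which telescopes to \<open>a\<^sub>i\<close>.
\<close>

lemma abel_summation:
  fixes a b :: "'b::comm_ring_1^('q::{finite,linorder})"
  shows "(\<Sum>r\<in>UNIV. (a $ r - next_or_0 a r) * (\<Sum>i\<le>r. b $ i)) = (\<Sum>i\<in>UNIV. a $ i * b $ i)"
proof -
  have "(\<Sum>r\<in>UNIV. (a $ r - next_or_0 a r) * (\<Sum>i\<le>r. b $ i)) =
      (\<Sum>r\<in>UNIV. \<Sum>i | i \<in> UNIV \<and> i \<le> r. (a $ r - next_or_0 a r) * b $ i)"
    by (simp add: sum_distrib_left atMost_def)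
  also have "\<dots> = (\<Sum>i\<in>UNIV. \<Sum>r | r \<in> UNIV \<and> i \<le> r. (a $ r - next_or_0 a r) * b $ i)"
    by (rule sum.swap_restrict) auto
  also have "\<dots> = (\<Sum>i\<in>UNIV. (\<Sum>r\<in>{i..}. a $ r - next_or_0 a r) * b $ i)"
    by (simp add: sum_distrib_right atLeast_def)
  finally show ?thesis by (simp add: sum_diff_next)
qed

lemma partial_sums_inject:
  fixes s t :: "real^('q::{finite,linorder})"
  assumes "\<And>r. (\<Sum>i\<le>r. s $ i) = (\<Sum>i\<le>r. t $ i)"
  shows "s = t"
proof -
  have "(\<Sum>i\<in>UNIV. axis j 1 $ i * s $ i) = (\<Sum>i\<in>UNIV. axis j 1 $ i * t $ i)" for j
    unfolding abel_summation[symmetric] by (simp add: assms)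
  then have "s $ j = t $ j" for j
    by (simp add: axis_def if_distrib if_distribR cong: if_cong)
  then show ?thesis by (simp add: vec_eq_iff)
qed

text \<open>
  The principal minors of \<open>x_mat t k\<close> determine all partial sums of \<open>s\<close>, which makes the definite description in
  \<open>iwasawa\<close> unique.
\<close>

lemma iwasawa_eqI:
  fixes s t :: "real^('q::{finite,linorder})" and k k' :: "('a::rch, 'q, 'r::finite) gmat"
  assumes k: "k \<in> grp_K" and k': "k' \<in> grp_K" "n \<in> grp_N" "a_mat t ** k = k' ** mexp (H_mat s) ** n"
  shows "iwasawa (a_mat t ** k) = s"
  unfolding iwasawa_def
proof (rule the_equality)
  fix s' assume "\<exists>k'\<in>grp_K. \<exists>n\<in>grp_N. a_mat t ** k = k' ** mexp (H_mat s') ** n"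
  then have "complex_of_real (exp (2 * (\<Sum>i\<le>r. s' $ i))) = of_real (exp (2 * (\<Sum>i\<le>r. s $ i)))" for r
    using minor_x_mat_of_iwasawa[OF k] k' by metis
  then show "s' = s"
    by (intro partial_sums_inject) (simp only: of_real_eq_iff exp_inj_iff, simp)
qed (use k' in blast)

lemma minor_x_mat:
  fixes t :: "real^('q::{finite,linorder})" and k :: "('a::rch, 'q, 'r::finite) gmat"
  assumes "k \<in> grp_K"
  shows "minor {..r} (x_mat t k) = of_real (exp (2 * (\<Sum>i\<le>r. iwasawa (a_mat t ** k) $ i)))"
  using iwasawa_exists[OF assms, of t] iwasawa_eqI[OF assms] minor_x_mat_of_iwasawa[OF assms] by metis

text \<open>
  The equality of the two integrands. The factor 2 in the exponent of the minors cancels the \<open>1 / 2\<close>.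
\<close>

lemma power_fun_x_mat:
  fixes t :: "real^('q::{finite,linorder})" and k :: "('a::rch, 'q, 'r::finite) gmat"
  assumes k: "k \<in> grp_K"
  shows "power_fun ((1 / 2) *s mu) (x_mat t k) = exp (pairing mu (iwasawa (a_mat t ** k)))"
proof -
  let ?s = "iwasawa (a_mat t ** k)"
  have "minor {..r} (x_mat t k) powr (((1 / 2) *s mu) $ r - (if {r<..} = {} then 0 else ((1 / 2) *s mu) $ Min {r<..})) =
      exp ((mu $ r - next_or_0 mu r) * (\<Sum>i\<le>r. of_real (?s $ i)))" for r
    by (simp add: minor_x_mat[OF k] powr_def Ln_of_real next_or_0_def algebra_simps del: of_real_exp)
  then have "power_fun ((1 / 2) *s mu) (x_mat t k) =
      exp (\<Sum>r\<in>UNIV. (mu $ r - next_or_0 mu r) * (\<Sum>i\<le>r. (\<chi> i. of_real (?s $ i)) $ i))"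
    by (simp add: power_fun_def exp_sum)
  then show ?thesis
    by (simp only: abel_summation) (simp add: pairing_def)
qed

lemma x_mat_pos_def:
  fixes t :: "real^('q::{finite,linorder})" and k :: "('a::rch, 'q, 'r::finite) gmat"
  assumes "k \<in> grp_K"
  shows "x_mat t k \<in> pos_def"
proof -
  obtain u v where uv: "k = block_diag u v" "u \<in> unitary" "v \<in> unitary"
    using assms by (auto simp: grp_K_def)
  let ?y = "y_mat t k"
  have "(\<Sum>i\<in>UNIV. conj (w $ i) * (x_mat t k *v w) $ i) = of_real ((norm (?y *v w))\<^sup>2)" for w
  proof -
    have "(\<Sum>i\<in>UNIV. conj (w $ i) * (x_mat t k *v w) $ i) =
        (\<Sum>i\<in>UNIV. \<Sum>j\<in>UNIV. conj (w $ i) * conj (?y $ j $ i) * (?y *v w) $ j)"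
      unfolding x_mat_eq matrix_vector_mul_assoc[symmetric]
      by (simp add: matrix_vector_mult_def[of "adj _"] sum_distrib_left mult.assoc)
    also have "\<dots> = (\<Sum>j\<in>UNIV. conj ((?y *v w) $ j) * (?y *v w) $ j)"
      by (subst sum.swap) (simp add: matrix_vector_mult_def conj_sum sum_distrib_right)
    also have "\<dots> = of_real ((norm (?y *v w))\<^sup>2)"
      by (simp add: conj_mult_self norm_vec_def L2_set_def sum_nonneg)
    finally show ?thesis .
  qed
  moreover have "0 < (norm (?y *v w))\<^sup>2" if "w \<noteq> 0" for w
    using y_mat_inj[OF uv(2,3), of t w] that uv(1) by auto
  moreover have "adj (x_mat t k) = x_mat t k"
    by (simp add: x_mat_eq)
  ultimately show ?thesis
    unfolding pos_def_def by blast
qed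

theorem theorem2p1:
  fixes dk :: "('a::rch, 'q::{finite,linorder}, 'r::finite) gmat measure"
    and lam :: "complex^('q::{finite,linorder})"
    and t :: "real^('q::{finite,linorder})"
  assumes "normalized_haar grp_K dk"
  shows "(\<forall>k\<in>(grp_K :: ('a, 'q, 'r) gmat set). x_mat t k \<in> pos_def) \<and>
    spherical_fun dk lam (a_mat t) =
      (\<integral>k. power_fun ((1 / 2) *s (\<i> *s lam - rhoBC DIM('a) CARD('q + 'r))) (x_mat t k) \<partial>dk)"
proof
  show "\<forall>k\<in>(grp_K :: ('a, 'q, 'r) gmat set). x_mat t k \<in> pos_def"
    by (simp add: x_mat_pos_def)
  have "sets dk = sets (restrict_space borel grp_K)"
    using assms by (simp add: normalized_haar_def)
  then have "space dk = grp_K"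
    by (simp add: sets_eq_imp_space_eq space_restrict_space)
  then show "spherical_fun dk lam (a_mat t) =
      (\<integral>k. power_fun ((1 / 2) *s (\<i> *s lam - rhoBC DIM('a) CARD('q + 'r))) (x_mat t k) \<partial>dk)"
    unfolding spherical_fun_def
    by (intro Bochner_Integration.integral_cong) (simp_all only: power_fun_x_mat)
qed

end
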